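(* Let $\Pi=(t_k)_{k\in\mathbb{Z}}$ be a strictly increasing sequence of real numbers with $\Delta_k=t_{k+1}-t_k=1$ for every $k\in\mathbb{Z}$, and let $\chi$ be a nonlinear kernel of starred type with data $(L,\psi,\alpha,\beta)$ relative to $\Pi$. Let $\varphi$ be a convex $\varphi$-function, and suppose that there is a convex $\varphi$-function $\eta$ such that for every $\lambda\in(0,1)$ there is a constant $C_\lambda\in(0,1)$ with $\varphi(C_\lambda\psi(u))\le\eta(\lambda u)$ for every $u\in\mathbb{R}^+_0$. Let $f\in L^{\varphi+\eta}_\mu(\mathbb{R}^+)$. Suppose also that for any fixed $0<\gamma<1$ there are positive constants $M_3,\gamma_0$ (depending on $\gamma$ and $L$) such that $$w\int_{|\ln y|>\frac{1}{w^\gamma}}L(y^w)\frac{dy}{y}\le M_3\,w^{-\gamma_0}$$ for all sufficiently large $w>0$. Then, for every $0<\gamma<1$ and corresponding $M_3,\gamma_0$, there exist $\nu>0$, $\lambda>0$ and $\lambda_0>0$ such that $$I^\varphi_\mu[\nu(K^\chi_wf-f)]\le\frac{\|L\|_{1,\mu}M_{0,\Pi}(\tau)}{3M_{0,\Pi}(L)}\,\widetilde\omega_{\eta,\mu}\Big(\lambda f,\frac{1}{w^\gamma}\Big)+\frac{M_3M_{0,\Pi}(\tau)\,I^\eta_\mu[\lambda_0f]}{3M_{0,\Pi}(L)}\,w^{-\gamma_0}+\frac13\,\widetilde\omega_{\eta,\mu}\Big(\lambda f,\frac1w\Big)+\frac{I^\varphi_\mu[\lambda_0f]}{3}\,w^{-\alpha}$$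 for every sufficiently large $w>0$, where $\tau$ is the characteristic function of the set $[1,e]$.
   Context: Notation: $\mathbb{R}^+=(0,\infty)$, $\mathbb{R}^+_0=[0,\infty)$; $\mu$ is the logarithmic (Haar) measure $\mu(A)=\int_A \frac{dt}{t}$ on $\mathbb{R}^+$, $L^1_\mu(\mathbb{R}^+)$ is the corresponding Lebesgue space and $\|\cdot\|_{1,\mu}$ its norm. A $\varphi$-function is a function $\varphi:\mathbb{R}^+_0\to\mathbb{R}^+_0$ that is non-decreasing and continuous, with $\varphi(0)=0$, $\varphi(u)>0$ for $u>0$, and $\varphi(u)\to+\infty$ as $u\to+\infty$. The associated modular is $I^\varphi_\mu[f]:=\int_0^{+\infty}\varphi(|f(x)|)\frac{dx}{x}$ for measurable $f:\mathbb{R}^+\to\mathbb{R}$, and the Mellin-Orlicz space is $L^\varphi_\mu(\mathbb{R}^+):=\{f \text{ measurable}: I^\varphi_\mu[\lambda f]<+\infty\text{ for some }\lambda>0\}$; $L^{\varphi+\eta}_\mu(\mathbb{R}^+)$ is the Mellin-Orlicz space generated by the $\varphi$-function $\varphi+\eta$. The log-modulus of smoothness with respect to $I^\eta_\mu$ is $$\widetilde\omega_{\eta,\mu}(f,\delta'):=\sup_{|\ln t|\le\delta'}I^\eta_\mu[f(\cdot\,t)-f(\cdot)]=\sup_{|\ln t|\le\delta'}\int_0^{+\infty}\eta(|f(st)-f(s)|)\frac{ds}{s},\qquad\delta'>0.$$ For a strictly increasing sequence $\Pi=(t_k)_{k\in\mathbb{Z}}$ of real numbers with $\Delta_k=t_{k+1}-t_k=1$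 for every $k\in\mathbb{Z}$ and $G:\mathbb{R}^+\to\mathbb{R}^+_0$, put $M_{\gamma,\Pi}(G):=\sup_{x\in\mathbb{R}^+}\sum_{k\in\mathbb{Z}}G(e^{-t_k}x)\,|\ln x-t_k|^\gamma$ for $\gamma>0$ and $M_{0,\Pi}(G):=\sup_{x\in\mathbb{R}^+}\sum_{k\in\mathbb{Z}}G(e^{-t_k}x)$. A nonlinear kernel of starred type with data $(L,\psi,\alpha,\beta)$, where $L:\mathbb{R}^+\to\mathbb{R}^+_0$ is measurable, $\psi:\mathbb{R}^+_0\to\mathbb{R}^+_0$ is non-decreasing and continuous with $\psi(0)=0$, and $\alpha,\beta>0$, is a function $\chi:\mathbb{R}^+\times\mathbb{R}\to\mathbb{R}$ such that: (1) $(\chi(e^{-t_k}x^w,u))_k\in\ell^1(\mathbb{Z})$ for every $x\in\mathbb{R}^+$, $u\in\mathbb{R}$, $w>0$; (2) $\chi(x,0)=0$ for every $x\in\mathbb{R}^+$; (3) $|\chi(x,u)-\chi(x,v)|\le L(x)\,\psi(|u-v|)$ for every $x\in\mathbb{R}^+$, $u,v\in\mathbb{R}$; (4* ) $\displaystyle\mathcal{T}_w(x):=\sup_{u\neq0}\Big|\frac1u\sum_{k\in\mathbb{Z}}\chi(e^{-t_k}x^w,u)-1\Big|=\mathcal{O}(w^{-\alpha})$ as $w\to+\infty$, uniformly with respect to $x\in\mathbb{R}^+$; (5) $L\in L^1_\mu(\mathbb{R}^+)$ and $L$ is bounded; (6) $M_{\beta,\Pi}(L)<+\infty$. For $w>0$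 and a locally integrable $f:\mathbb{R}^+\to\mathbb{R}$ for which the series converges for every $x$, the nonlinear exponential Kantorovich sampling operator is $$(K^\chi_w f)(x):=\sum_{k\in\mathbb{Z}}\chi\Big(e^{-t_k}x^w,\ \frac{w}{\Delta_k}\int_{t_k/w}^{t_{k+1}/w}f(e^u)\,du\Big),\qquad x\in\mathbb{R}^+.$$ *)

theory Defs
  imports "HOL-Analysis.Analysis"
begin

text \<open>
  Functions on the open half-line are total functions on \<^typ>\<open>real\<close> whose values outside
  \<open>{0<..}\<close> (for Young-type functions: outside \<open>{0..}\<close>) are never used.
\<close>

text \<open>
  The sigma-algebra consists of the Lebesgue measurable subsets of the half-line, so
  \<open>borel_measurable log_measure\<close> is Lebesgue measurability on \<open>{0<..}\<close>.
\<close>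

definition log_measure :: "real measure"
  where "log_measure = density (lebesgue_on {0<..}) (\<lambda>t. ennreal (1 / t))"

definition phi_function :: "(real \<Rightarrow> real) \<Rightarrow> bool"
  where "phi_function \<phi> \<longleftrightarrow>
    mono_on {0..} \<phi> \<and> continuous_on {0..} \<phi> \<and> \<phi> 0 = 0 \<and> (\<forall>u>0. \<phi> u > 0) \<and>
    filterlim \<phi> at_top at_top"

definition modular :: "(real \<Rightarrow> real) \<Rightarrow> (real \<Rightarrow> real) \<Rightarrow> ennreal"
  where "modular \<phi> f = (\<integral>\<^sup>+x. ennreal (\<phi> \<bar>f x\<bar>) \<partial>log_measure)"

definition mellin_orlicz :: "(real \<Rightarrow> real) \<Rightarrow> (real \<Rightarrow> real) set"
  where "mellin_orlicz \<phi> =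
    {f \<in> borel_measurable log_measure. \<exists>c>0. modular \<phi> (\<lambda>x. c * f x) < \<infinity>}"

definition log_modulus :: "(real \<Rightarrow> real) \<Rightarrow> (real \<Rightarrow> real) \<Rightarrow> real \<Rightarrow> ennreal"
  where "log_modulus \<eta> f \<delta> =
    (SUP t\<in>{t. t > 0 \<and> \<bar>ln t\<bar> \<le> \<delta>}. modular \<eta> (\<lambda>s. f (s * t) - f s))"

text \<open>The case distinction is needed because \<open>0 powr 0 = 0\<close>.\<close>

definition abs_moment :: "real \<Rightarrow> (int \<Rightarrow> real) \<Rightarrow> (real \<Rightarrow> real) \<Rightarrow> ennreal"
  where "abs_moment \<gamma> t G =
    (SUP x\<in>{0<..}. \<Sum>\<^sub>\<infinity>k. ennreal
       (G (exp (- t k) * x) * (if \<gamma> = 0 then 1 else \<bar>ln x - t k\<bar> powr \<gamma>)))"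

definition kernel_defect ::
    "(int \<Rightarrow> real) \<Rightarrow> (real \<Rightarrow> real \<Rightarrow> real) \<Rightarrow> real \<Rightarrow> real \<Rightarrow> ennreal"
  where "kernel_defect t \<kappa> w x =
    (SUP u\<in>- {0}. ennreal \<bar>1 / u * (\<Sum>\<^sub>\<infinity>k. \<kappa> (exp (- t k) * x powr w) u) - 1\<bar>)"

definition starred_kernel ::
    "(int \<Rightarrow> real) \<Rightarrow> (real \<Rightarrow> real) \<Rightarrow> (real \<Rightarrow> real) \<Rightarrow> real \<Rightarrow> real \<Rightarrow>
     (real \<Rightarrow> real \<Rightarrow> real) \<Rightarrow> bool"
  where "starred_kernel t L \<psi> \<alpha> \<beta> \<kappa> \<longleftrightarrow>
    L \<in> borel_measurable log_measure \<and> (\<forall>x>0. L x \<ge> 0) \<and>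
    mono_on {0..} \<psi> \<and> continuous_on {0..} \<psi> \<and> \<psi> 0 = 0 \<and>
    \<alpha> > 0 \<and> \<beta> > 0 \<and>
    (\<forall>x>0. \<forall>u. \<forall>w>0. (\<lambda>k. \<bar>\<kappa> (exp (- t k) * x powr w) u\<bar>) summable_on UNIV) \<and>
    (\<forall>x>0. \<kappa> x 0 = 0) \<and>
    (\<forall>x>0. \<forall>u v. \<bar>\<kappa> x u - \<kappa> x v\<bar> \<le> L x * \<psi> \<bar>u - v\<bar>) \<and>
    (\<exists>C. \<forall>\<^sub>F w in at_top. \<forall>x>0. kernel_defect t \<kappa> w x \<le> ennreal (C * w powr (- \<alpha>))) \<and>
    integrable log_measure L \<and> bounded (L ` {0<..}) \<and>
    abs_moment \<beta> t L < \<infinity>"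

text \<open>
  The mean values use the Lebesgue integral over \<^term>\<open>lebesgue\<close> rather than
  \<^term>\<open>lborel\<close>, since \<open>f\<close> is only Lebesgue measurable.
\<close>

definition kantorovich ::
    "(int \<Rightarrow> real) \<Rightarrow> (real \<Rightarrow> real \<Rightarrow> real) \<Rightarrow> real \<Rightarrow> (real \<Rightarrow> real) \<Rightarrow> real \<Rightarrow> real"
  where "kantorovich t \<kappa> w f x =
    (\<Sum>\<^sub>\<infinity>k. \<kappa> (exp (- t k) * x powr w)
       (w / (t (k + 1) - t k) * (LINT u:{t k / w..t (k + 1) / w}|lebesgue. f (exp u))))"

definition tail_decay :: "(real \<Rightarrow> real) \<Rightarrow> real \<Rightarrow> real \<Rightarrow> real \<Rightarrow> bool"
  where "tail_decay L \<gamma> M \<gamma>\<^sub>0 \<longleftrightarrow>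
    (\<forall>\<^sub>F w in at_top.
       ennreal w * (\<integral>\<^sup>+y\<in>{y. \<bar>ln y\<bar> > 1 / w powr \<gamma>}. ennreal (L (y powr w)) \<partial>log_measure)
         \<le> ennreal (M * w powr (- \<gamma>\<^sub>0)))"

end

theory Submission
  imports Defs
begin

text \<open>
  In the coordinate \<open>v = ln x\<close> the measure \<open>log_measure\<close> is Lebesgue measure and dilations are
  translations; there \<open>f\<close> and \<open>L\<close> are replaced by Borel functions \<open>G\<close> and \<open>\<l>\<close> to which Fubini's theorem
  applies. The error at \<open>x\<close> is at most \<open>\<Sum>\<^sub>k L(e\<^bsup>-t k\<^esup> x\<^bsup>w\<^esup>) \<psi>(\<bar>m\<^sub>k - f x\<bar>)\<close>, where \<open>m\<^sub>k\<close> is the mean value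
  over the \<open>k\<close>-th cell, plus \<open>\<bar>f x\<bar>\<close> times the kernel defect. The difference \<open>m\<^sub>k - f x\<close> is split at
  the mean of \<open>G(v + s)\<close> over \<open>0 \<le> s \<le> 1/w\<close>, and convexity of \<open>\<phi>\<close> gives each of the three resulting terms
  the factor \<open>1/3\<close>. Jensen's inequality, first for the sum with weights \<open>L\<close> of total mass at most
  \<open>M\<^sub>0(L)\<close> and, after \<open>\<phi>(C \<psi>(u)) \<le> \<eta>(\<rho> u)\<close>, for the means, brings \<open>\<eta>\<close> inside. In the first term the shift
  \<open>v = t\<^sub>k/w + r\<close> then makes the weight \<open>\<l>(w r)\<close> independent of \<open>k\<close>, so that the cells add up to the whole
  line and the modular of \<open>G(\<cdot> + r) - G\<close> appears, which is estimated by the modulus of smoothness for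
  \<open>\<bar>r\<bar> \<le> w\<^bsup>-\<gamma>\<^esup>\<close> and by the modular of a multiple of \<open>G\<close> together with the tail decay for other \<open>r\<close>.
\<close>

section \<open>Infinite sums as integrals\<close>

text \<open>Both sides are suprema of finite partial sums; for the lower bound on
  \<open>infsum\<close> the index type is enumerated by \<open>to_nat\<close>. The series in the
  moments thus become integrals, to which Tonelli's theorem applies.\<close>

lemma infsum_eq_nn_integral_count_space:
  fixes g :: "'a::countable \<Rightarrow> ennreal"
  shows "infsum g UNIV = (\<integral>\<^sup>+k. g k \<partial>count_space UNIV)"
proof (rule antisym)
  have S: "infsum g UNIV = (SUP F\<in>{F. finite F \<and> F \<subseteq> UNIV}. sum g F)"
    by (rule nonneg_infsum_complete) auto
  show "infsum g UNIV \<le> (\<integral>\<^sup>+k. g k \<partial>count_space UNIV)"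
    unfolding S
  proof (rule SUP_least)
    fix F :: "'a set" assume "F \<in> {F. finite F \<and> F \<subseteq> UNIV}"
    then have F: "finite F" by auto
    have "sum g F = (\<integral>\<^sup>+k. g k \<partial>count_space F)"
      using F by (simp add: nn_integral_count_space_finite)
    also have "\<dots> = (\<integral>\<^sup>+k. g k * indicator F k \<partial>count_space UNIV)"
      by (simp add: nn_integral_count_space_indicator)
    also have "\<dots> \<le> (\<integral>\<^sup>+k. g k \<partial>count_space UNIV)"
      by (intro nn_integral_mono) (auto split: split_indicator)
    finally show "sum g F \<le> (\<integral>\<^sup>+k. g k \<partial>count_space UNIV)" .
  qed
  show "(\<integral>\<^sup>+k. g k \<partial>count_space UNIV) \<le> infsum g UNIV"
  proof -
    have "(\<integral>\<^sup>+k. g k \<partial>count_space UNIV)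
        = (\<integral>\<^sup>+n. g (from_nat n) \<partial>count_space (to_nat ` (UNIV::'a set)))"
      by (subst nn_integral_bij_count_space[symmetric, where g="to_nat" and A=UNIV])
        (auto simp: bij_betw_def)
    also have "\<dots> = (\<integral>\<^sup>+n. g (from_nat n) * indicator (to_nat ` (UNIV::'a set)) n \<partial>count_space UNIV)"
      by (simp add: nn_integral_count_space_indicator)
    also have "\<dots> = (\<Sum>n. g (from_nat n) * indicator (to_nat ` (UNIV::'a set)) n)"
      by (rule nn_integral_count_space_nat)
    also have "\<dots> \<le> infsum g UNIV"
    proof (rule suminf_le_const)
      fix n
      let ?F = "{k::'a. to_nat k < n}"
      have fin: "finite ?F"
        by (rule finite_imageD[where f=to_nat]) (auto intro: finite_subset[of _ "{..<n}"] simp: inj_on_def)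
      have "(\<Sum>i<n. g (from_nat i) * indicator (to_nat ` (UNIV::'a set)) i)
          = (\<Sum>i\<in>to_nat ` ?F. g (from_nat i) * indicator (to_nat ` (UNIV::'a set)) i)"
        by (rule sum.mono_neutral_right) (auto simp: indicator_def)
      also have "\<dots> = sum g ?F"
        by (subst sum.reindex) (auto simp: inj_on_def)
      also have "\<dots> \<le> infsum g UNIV" unfolding S
        by (rule SUP_upper) (use fin in auto)
      finally show "(\<Sum>i<n. g (from_nat i) * indicator (to_nat ` (UNIV::'a set)) i) \<le> infsum g UNIV" .
    qed auto
    finally show ?thesis .
  qed
qed

text \<open>The integral bounds every finite partial sum. This is the way back from a finite
  extended value to a convergent series of reals.\<close>

lemma summable_on_nn_integral_count_space:
  fixes h :: "'a::countable \<Rightarrow> real"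
  assumes h: "\<And>k. 0 \<le> h k" and fin: "(\<integral>\<^sup>+k. ennreal (h k) \<partial>count_space UNIV) < \<infinity>"
  shows "h summable_on UNIV"
    and "ennreal (infsum h UNIV) = (\<integral>\<^sup>+k. ennreal (h k) \<partial>count_space UNIV)"
proof -
  show s: "h summable_on UNIV"
  proof (rule nonneg_bdd_above_summable_on)
    show "bdd_above (sum h ` {F. F \<subseteq> UNIV \<and> finite F})"
    proof (rule bdd_aboveI2)
      fix F :: "'a set" assume "F \<in> {F. F \<subseteq> UNIV \<and> finite F}"
      then have F: "finite F" by auto
      have "ennreal (sum h F) = (\<Sum>k\<in>F. ennreal (h k))" using h by (simp add: sum_ennreal)
      also have "\<dots> \<le> infsum (\<lambda>k. ennreal (h k)) UNIV"
        unfolding nonneg_infsum_complete[of UNIV "\<lambda>k. ennreal (h k)", simplified]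
        using F by (auto intro: SUP_upper)
      also have "\<dots> = ennreal (enn2real (\<integral>\<^sup>+k. ennreal (h k) \<partial>count_space UNIV))"
        using fin by (simp add: infsum_eq_nn_integral_count_space)
      finally show "sum h F \<le> enn2real (\<integral>\<^sup>+k. ennreal (h k) \<partial>count_space UNIV)"
        by (subst (asm) ennreal_le_iff) auto
    qed
  qed (use h in auto)
  have "(\<integral>\<^sup>+k. ennreal (h k) \<partial>count_space UNIV) = (SUP F\<in>{F. finite F \<and> F \<subseteq> UNIV}. (\<Sum>k\<in>F. ennreal (h k)))"
    unfolding infsum_eq_nn_integral_count_space[symmetric]
    by (rule nonneg_infsum_complete) auto
  also have "\<dots> = ennreal (infsum h UNIV)"
    using infsum_nonneg_is_SUPREMUM_ennreal[OF s h] h by (simp add: sum_ennreal)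
  finally show "ennreal (infsum h UNIV) = (\<integral>\<^sup>+k. ennreal (h k) \<partial>count_space UNIV)" by simp
qed

text \<open>If the right-hand side is finite, then \<open>a - b\<close>, and with \<open>b\<close>
  also \<open>a\<close>, is summable; otherwise the bound is trivial. So the series of the operator
  can be compared with one known to converge absolutely.\<close>

lemma abs_infsum_diff_le_nn_integral:
  fixes a b :: "'a::countable \<Rightarrow> real"
  assumes b: "(\<lambda>k. \<bar>b k\<bar>) summable_on UNIV"
  shows "ennreal \<bar>infsum a UNIV - infsum b UNIV\<bar> \<le> (\<integral>\<^sup>+k. ennreal \<bar>a k - b k\<bar> \<partial>count_space UNIV)"
proof (cases "(\<integral>\<^sup>+k. ennreal \<bar>a k - b k\<bar> \<partial>count_space UNIV) < \<infinity>")
  case True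
  have s: "(\<lambda>k. \<bar>a k - b k\<bar>) summable_on UNIV"
    "ennreal (infsum (\<lambda>k. \<bar>a k - b k\<bar>) UNIV) = (\<integral>\<^sup>+k. ennreal \<bar>a k - b k\<bar> \<partial>count_space UNIV)"
    using summable_on_nn_integral_count_space[of "\<lambda>k. \<bar>a k - b k\<bar>", OF abs_ge_zero True] by blast+
  have bs: "b summable_on UNIV" using b by (simp add: abs_summable_summable)
  have ds: "(\<lambda>k. a k - b k) summable_on UNIV" using s(1) by (simp add: abs_summable_summable)
  have "\<bar>infsum a UNIV - infsum b UNIV\<bar> = norm (infsum (\<lambda>k. a k - b k) UNIV)"
    using infsum_add[OF ds bs] by simp
  also have "\<dots> \<le> infsum (\<lambda>k. \<bar>a k - b k\<bar>) UNIV"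
    using norm_infsum_bound[of "\<lambda>k. a k - b k" UNIV] s(1) by simp
  finally show ?thesis unfolding s(2)[symmetric] by (rule ennreal_leI)
next
  case False
  then have "(\<integral>\<^sup>+k. ennreal \<bar>a k - b k\<bar> \<partial>count_space UNIV) = top"
    by (metis less_top infinity_ennreal_def)
  then show ?thesis by simp
qed

text \<open>Countability of the index type gives joint measurability in \<open>v\<close> and
  \<open>k\<close> from measurability for each fixed \<open>k\<close>.\<close>

lemma borel_measurable_nn_integral_count_space:
  fixes g :: "'b \<Rightarrow> 'a::countable \<Rightarrow> ennreal"
  assumes [measurable]: "\<And>k. (\<lambda>v. g v k) \<in> borel_measurable M"
  shows "(\<lambda>v. \<integral>\<^sup>+k. g v k \<partial>count_space UNIV) \<in> borel_measurable M"
proof -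
  interpret sigma_finite_measure "count_space (UNIV :: 'a set)"
    by (rule sigma_finite_measure_count_space)
  have "(\<lambda>p. g (snd p) (fst p)) \<in> borel_measurable (count_space (UNIV :: 'a set) \<Otimes>\<^sub>M M)"
    by (rule measurable_pair_measure_countable1) auto
  from measurable_pair_swap[OF this]
  have "case_prod g \<in> borel_measurable (M \<Otimes>\<^sub>M count_space UNIV)" by simp
  then show ?thesis by (rule borel_measurable_nn_integral)
qed

section \<open>The logarithmic coordinate\<close>

text \<open>The image of \<open>dx / x\<close> under \<open>ln\<close> gives the interval from
  \<open>a\<close> to \<open>b\<close> the mass \<open>ln (exp b) - ln (exp a) = b - a\<close>,
  which characterises Lebesgue measure.\<close>

lemma nn_integral_log_measure_ln:
  assumes B[measurable]: "B \<in> borel_measurable borel"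
  shows "(\<integral>\<^sup>+x. B (ln x) \<partial>log_measure) = (\<integral>\<^sup>+v. B v \<partial>lborel)"
proof -
  have "distr (density lborel (\<lambda>x. ennreal (indicator {0<..} x / x))) borel ln = lborel"
  proof (rule lborel_eqI[symmetric])
    fix a b :: real assume "\<And>i. i \<in> Basis \<Longrightarrow> a \<bullet> i \<le> b \<bullet> i"
    then have ab: "a \<le> b" by simp
    have [measurable]: "ln -` {a<..<b} \<in> sets borel"
      using measurable_sets[of ln borel borel "{a<..<b}"] by simp
    have "emeasure (distr (density lborel (\<lambda>x. ennreal (indicator {0<..} x / x))) borel ln) (box a b)
        = (\<integral>\<^sup>+x. ennreal (indicator {0<..} x / x) * indicator (ln -` {a<..<b}) x \<partial>lborel)"
      by (simp add: emeasure_distr emeasure_density)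
    \<comment> \<open>The preimage under \<open>ln\<close> is taken in all of \<open>real\<close>,
      and the density removes its points outside the half-line. Closing the interval changes only
      two points and prepares the fundamental theorem of calculus.\<close>
    also have "\<dots> = (\<integral>\<^sup>+x. ennreal (1/x) * indicator {exp a..exp b} x \<partial>lborel)"
    proof (rule nn_integral_cong_AE)
      have "AE x in lborel. x \<noteq> exp a \<and> x \<noteq> exp b" by (auto intro: AE_lborel_singleton)
      then show "AE x in lborel. ennreal (indicator {0<..} x / x) * indicator (ln -` {a<..<b}) x
          = ennreal (1/x) * indicator {exp a..exp b} x"
      proof eventually_elim
        case (elim x)
        show ?case
        proof (cases "x > 0")
          case True
          then obtain y where "x = exp y" by (metis exp_ln)
          then show ?thesis using elim by (auto simp: indicator_def)
        next
          case False
          have "x \<notin> {exp a..exp b}" using False exp_gt_zero[of a] by (auto simp del: exp_gt_zero)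
          then show ?thesis using False by auto
        qed
      qed
    qed
    also have "\<dots> = ennreal (ln (exp b) - ln (exp a))"
    proof (rule nn_integral_FTC_Icc)
      fix x assume "x \<in> {exp a..exp b}"
      then have "exp a \<le> x" by simp
      then have "x > 0" using exp_gt_zero[of a] by linarith
      then show "(ln has_real_derivative 1 / x) (at x)" "0 \<le> 1 / x"
        by (auto intro!: derivative_eq_intros simp: field_simps)
    qed (use ab in simp_all)
    finally show "emeasure (distr (density lborel (\<lambda>x. ennreal (indicator {0<..} x / x))) borel ln) (box a b)
        = ennreal (\<Prod>i\<in>Basis. (b - a) \<bullet> i)" by simp
  qed simp
  then have "(\<integral>\<^sup>+v. B v \<partial>lborel)
      = (\<integral>\<^sup>+v. B v \<partial>distr (density lborel (\<lambda>x. ennreal (indicator {0<..} x / x))) borel ln)" by simp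
  also have "\<dots> = (\<integral>\<^sup>+x. ennreal (indicator {0<..} x / x) * B (ln x) \<partial>lborel)"
    by (simp add: nn_integral_distr nn_integral_density)
  also have "\<dots> = (\<integral>\<^sup>+x. ennreal (indicator {0<..} x / x) * B (ln x) \<partial>lebesgue)"
    by (simp add: nn_integral_completion)
  also have "\<dots> = (\<integral>\<^sup>+x. (ennreal (1 / x) * B (ln x)) * indicator {0<..} x \<partial>lebesgue)"
    by (intro nn_integral_cong) (auto simp: indicator_def)
  also have "\<dots> = (\<integral>\<^sup>+x. ennreal (1 / x) * B (ln x) \<partial>lebesgue_on {0<..})"
    by (subst nn_integral_restrict_space) auto
  also have "\<dots> = (\<integral>\<^sup>+x. B (ln x) \<partial>log_measure)"
    unfolding log_measure_def
    by (rule nn_integral_density[symmetric]) (auto intro!: measurable_restrict_space1 measurable_completion)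
  finally show ?thesis by simp
qed

lemma space_log_measure: "space log_measure = {0<..}"
  by (simp add: log_measure_def)

lemma borel_measurable_log_measureI:
  fixes g :: "real \<Rightarrow> 'a::topological_space"
  assumes "g \<in> borel_measurable borel" shows "g \<in> borel_measurable log_measure"
  unfolding log_measure_def measurable_density_eq1
  using assms by (intro measurable_restrict_space1 measurable_completion) simp

text \<open>The preceding substitution, applied to the indicator of a Borel null set, shows that its
  preimage under \<open>ln\<close> is null.\<close>

lemma AE_log_measure_ln:
  assumes "AE v in lborel. P v"
  shows "AE x in log_measure. P (ln x)"
proof -
  obtain N where N: "{v \<in> space lborel. \<not> P v} \<subseteq> N" "emeasure lborel N = 0" "N \<in> sets lborel"
    by (rule AE_E[OF assms])
  have m: "{x \<in> space log_measure. ln x \<in> N} \<in> sets log_measure"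
    using N(3) by (intro measurable_sets_Collect[OF borel_measurable_log_measureI]) auto
  have "(\<integral>\<^sup>+x. indicator N (ln x) \<partial>log_measure) = 0"
    using N by (subst nn_integral_log_measure_ln) auto
  also have "(\<integral>\<^sup>+x. indicator N (ln x) \<partial>log_measure)
      = (\<integral>\<^sup>+x. indicator {x \<in> space log_measure. ln x \<in> N} x \<partial>log_measure)"
    by (intro nn_integral_cong) (auto simp: indicator_def)
  finally have "emeasure log_measure {x \<in> space log_measure. ln x \<in> N} = 0" using m by simp
  then show ?thesis using N(1) m by (intro AE_I) auto
qed

text \<open>The substitution is read backwards: the preimage of a null set \<open>N\<close> under
  \<open>exp\<close> has the Lebesgue measure that \<open>log_measure\<close> gives to
  \<open>N\<close>, and this is zero because \<open>log_measure\<close> has a density.\<close>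

lemma AE_exp_lborel:
  fixes P :: "real \<Rightarrow> bool"
  assumes "AE x in lborel. P x"
  shows "AE v in lborel. P (exp v)"
proof -
  obtain N where N: "{v \<in> space lborel. \<not> P v} \<subseteq> N" "emeasure lborel N = 0" "N \<in> sets lborel"
    by (rule AE_E[OF assms])
  have Nb[measurable]: "N \<in> sets borel" using N(3) by simp
  have zero: "(\<integral>\<^sup>+v. indicator N (exp v) \<partial>lborel) = 0"
  proof -
    have "(\<integral>\<^sup>+v. indicator N (exp v) \<partial>lborel) = (\<integral>\<^sup>+x. indicator N (exp (ln x)) \<partial>log_measure)"
      by (rule nn_integral_log_measure_ln[symmetric]) measurable
    also have "\<dots> = (\<integral>\<^sup>+x. 0 \<partial>log_measure)"
    proof (rule nn_integral_cong_AE)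
      have "AE x in lebesgue. x \<notin> N"
        using N by (intro AE_completion AE_not_in) (auto simp: null_sets_def)
      then have "AE x in lebesgue_on {0<..}. x \<notin> N"
        by (subst AE_restrict_space_iff) auto
      then show "AE x in log_measure. indicator N (exp (ln x)) = (0::ennreal)"
        unfolding log_measure_def
        by (subst AE_density) (auto intro!: measurable_restrict_space1 measurable_completion simp: AE_restrict_space_iff)
    qed
    finally show ?thesis by simp
  qed
  have "AE v in lborel. (indicator N (exp v) :: ennreal) = 0"
    using zero by (subst (asm) nn_integral_0_iff_AE) auto
  then show ?thesis
  proof eventually_elim
    case (elim v)
    then show ?case using N(1) by (auto simp: indicator_def split: if_splits)
  qed
qed

text \<open>Extended by zero, \<open>f\<close> is Lebesgue measurable on the line and agrees almost
  everywhere with a Borel function; pulling back along \<open>exp\<close> keeps the exceptional set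
  null.\<close>

lemma borel_version_exp:
  fixes f :: "real \<Rightarrow> real"
  assumes "f \<in> borel_measurable log_measure"
  obtains G where "G \<in> borel_measurable borel" "AE v in lborel. f (exp v) = G v"
proof -
  have "f \<in> borel_measurable (lebesgue_on {0<..})"
    using assms unfolding log_measure_def by simp
  then have "(\<lambda>x. indicator {0<..} x *\<^sub>R f x) \<in> borel_measurable lebesgue"
    by (subst (asm) borel_measurable_restrict_space_iff) auto
  from completion_ex_borel_measurable_real[OF this]
  obtain g where g: "g \<in> borel_measurable borel" "AE x in lborel. indicator {0<..} x *\<^sub>R f x = g x" by auto
  from AE_exp_lborel[OF g(2)] have "AE v in lborel. f (exp v) = g (exp v)" by simp
  then show ?thesis using g(1) by (intro that[of "\<lambda>v. g (exp v)"]) auto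
qed

section \<open>Convex Young functions\<close>

lemma phi_function_nonneg: "phi_function \<phi> \<Longrightarrow> 0 \<le> u \<Longrightarrow> 0 \<le> \<phi> u"
  unfolding phi_function_def by (metis less_eq_real_def)

lemma phi_function_mono: "phi_function \<phi> \<Longrightarrow> 0 \<le> u \<Longrightarrow> u \<le> v \<Longrightarrow> \<phi> u \<le> \<phi> v"
  unfolding phi_function_def by (auto intro: mono_onD)

lemma borel_measurable_phi_abs:
  assumes "phi_function \<phi>"
  shows "(\<lambda>x. \<phi> \<bar>x\<bar>) \<in> borel_measurable borel"
proof (rule borel_measurable_continuous_onI)
  have "continuous_on {0..} \<phi>" using assms by (simp add: phi_function_def)
  then show "continuous_on UNIV (\<lambda>x. \<phi> \<bar>x\<bar>)"
    by (rule continuous_on_compose2) (auto intro: continuous_intros)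
qed

lemma borel_measurable_phi_abs_compose:
  assumes "phi_function \<phi>" "f \<in> borel_measurable M"
  shows "(\<lambda>x. \<phi> \<bar>f x\<bar>) \<in> borel_measurable M"
  using measurable_compose[OF assms(2) borel_measurable_phi_abs[OF assms(1)]] .

lemma phi_function_scale_le:
  assumes "phi_function \<phi>" "convex_on {0..} \<phi>" "0 \<le> c" "c \<le> 1" "0 \<le> u"
  shows "\<phi> (c * u) \<le> c * \<phi> u"
  using convex_onD[OF assms(2), of c 0 u] assms by (simp add: phi_function_def)

lemma convex_add2_le:
  fixes \<phi> :: "real \<Rightarrow> real"
  assumes "convex_on {0..} \<phi>" "0 \<le> a" "0 \<le> b"
  shows "\<phi> (a + b) \<le> (\<phi> (2 * a) + \<phi> (2 * b)) / 2"
  using convex_onD[OF assms(1), of "1/2" "2 * a" "2 * b"] assms by simp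

text \<open>The sum is the mean of \<open>3/2 * (a + b)\<close> and \<open>3 * c\<close> with
  weights 2/3 and 1/3, and the first of these points is the midpoint of \<open>3 * a\<close> and
  \<open>3 * b\<close>.\<close>

lemma convex_add3_le:
  fixes \<phi> :: "real \<Rightarrow> real"
  assumes "convex_on {0..} \<phi>" "0 \<le> a" "0 \<le> b" "0 \<le> c"
  shows "\<phi> (a + b + c) \<le> (\<phi> (3 * a) + \<phi> (3 * b) + \<phi> (3 * c)) / 3"
proof -
  have "\<phi> (a + b + c) \<le> (1 - 1/3) * \<phi> (3/2 * (a + b)) + 1/3 * \<phi> (3 * c)"
  proof -
    have "\<phi> ((1 - 1/3) *\<^sub>R (3/2 * (a + b)) + (1/3) *\<^sub>R (3 * c))
        \<le> (1 - 1/3) * \<phi> (3/2 * (a + b)) + 1/3 * \<phi> (3 * c)"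
      by (rule convex_onD[OF assms(1)]) (use assms in auto)
    moreover have "(1 - 1/3) *\<^sub>R (3/2 * (a + b)) + (1/3) *\<^sub>R (3 * c) = a + b + c"
      by (simp add: field_simps)
    ultimately show ?thesis by (simp only:)
  qed
  moreover have "\<phi> (3/2 * (a + b)) \<le> (\<phi> (3 * a) + \<phi> (3 * b)) / 2"
    using convex_add2_le[OF assms(1), of "3/2 * a" "3/2 * b"] assms
    unfolding distrib_left[symmetric] by simp
  ultimately show ?thesis by argo
qed

text \<open>
  A total mass of at most \<open>M\<close> is enough because \<open>\<phi> 0 = 0\<close>: the missing mass can be placed where
  \<open>h\<close> vanishes. The hypothesis on \<open>r\<close> replaces an integrability assumption on \<open>h\<close>.
\<close>

lemma jensen_submass:
  assumes phi: "phi_function \<phi>" and conv: "convex_on {0..} \<phi>"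
    and h[measurable]: "h \<in> borel_measurable N"
    and M: "0 < M" "emeasure N (space N) \<le> ennreal M"
    and r: "0 \<le> r" "ennreal r \<le> (\<integral>\<^sup>+x. ennreal \<bar>h x\<bar> \<partial>N)"
  shows "ennreal (M * \<phi> (r / M)) \<le> (\<integral>\<^sup>+x. ennreal (\<phi> \<bar>h x\<bar>) \<partial>N)"
proof (cases "r = 0 \<or> (\<integral>\<^sup>+x. ennreal (\<phi> \<bar>h x\<bar>) \<partial>N) = \<infinity>")
  case True
  then show ?thesis using phi by (auto simp: phi_function_def)
next
  case False
  then obtain X where X: "(\<integral>\<^sup>+x. ennreal (\<phi> \<bar>h x\<bar>) \<partial>N) = ennreal X" "0 \<le> X"
    by (cases "\<integral>\<^sup>+x. ennreal (\<phi> \<bar>h x\<bar>) \<partial>N") auto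
  note [measurable] = borel_measurable_phi_abs_compose[OF phi h]
  define m where "m = r / M"
  have m: "0 < m" "m * M = r" using False r M unfolding m_def by auto
  \<comment> \<open>\<open>s\<close> is the slope of a supporting line of \<open>\<phi>\<close> at
    the point \<open>m = r / M\<close>.\<close>
  obtain s where s: "\<And>y. 0 \<le> y \<Longrightarrow> \<phi> m + s * (y - m) \<le> \<phi> y"
    using convex_le_Inf_differential[OF conv, of m] m(1) by (auto simp: interior_Ici[of "-1"])
  \<comment> \<open>At 0 the supporting line lies below \<open>\<phi> 0 = 0\<close>. Multiplied by
    \<open>M - A\<close>, this inequality later accounts for the missing mass.\<close>
  have sm: "\<phi> m \<le> s * m" using s[of 0] phi by (simp add: phi_function_def)
  have phim: "0 < \<phi> m" using m phi by (simp add: phi_function_def)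
  then have s0: "0 \<le> s" using sm m(1) by (smt (verit) zero_less_mult_pos2)
  obtain A where A: "emeasure N (space N) = ennreal A" "0 \<le> A"
    using M(2) by (cases "emeasure N (space N)") (auto simp: top_unique)
  have AM: "A \<le> M" using A M by simp
  \<comment> \<open>The supporting line is integrated with its negative term \<open>s * m\<close>
    moved to the other side, so that all integrands stay nonnegative.\<close>
  have "ennreal (\<phi> m * A + s * r) \<le> ennreal (\<phi> m) * ennreal A + ennreal s * (\<integral>\<^sup>+x. ennreal \<bar>h x\<bar> \<partial>N)"
    using s0 phim A r by (auto simp: ennreal_mult'' ennreal_plus intro!: add_mono mult_left_mono)
  also have "\<dots> = (\<integral>\<^sup>+x. ennreal (\<phi> m + s * \<bar>h x\<bar>) \<partial>N)"
    using s0 phim A(1) by (simp add: ennreal_mult' ennreal_plus nn_integral_add nn_integral_cmult)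
  also have "\<dots> \<le> (\<integral>\<^sup>+x. ennreal (\<phi> \<bar>h x\<bar> + s * m) \<partial>N)"
  proof (intro nn_integral_mono ennreal_leI)
    fix x show "\<phi> m + s * \<bar>h x\<bar> \<le> \<phi> \<bar>h x\<bar> + s * m" using s[of "\<bar>h x\<bar>"] by (simp add: algebra_simps)
  qed
  also have "\<dots> = ennreal X + ennreal (s * m) * ennreal A"
    using s0 m phi_function_nonneg[OF phi] A(1) X(1) by (simp add: ennreal_plus nn_integral_add)
  also have "\<dots> = ennreal (X + s * m * A)"
    using X(2) s0 m A(2) by (simp add: ennreal_plus ennreal_mult'')
  finally have "\<phi> m * A + s * r \<le> X + s * m * A"
    using X(2) s0 m A(2) by (subst (asm) ennreal_le_iff) auto
  moreover have "\<phi> m * (M - A) \<le> s * m * (M - A)" using sm AM by (intro mult_right_mono) auto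
  moreover have "s * r = s * m * M" by (simp add: m(2)[symmetric])
  ultimately have "M * \<phi> m \<le> X" by (simp only: right_diff_distrib) argo
  then show ?thesis unfolding X(1) m_def by (rule ennreal_leI)
qed

section \<open>Moments and cell averages\<close>

lemma unit_step_eq:
  fixes t :: "int \<Rightarrow> real"
  assumes "\<And>k. t (k + 1) - t k = 1"
  shows "t k = t 0 + of_int k"
proof (induction k rule: int_induct[of _ 0])
  case (step1 i)
  then show ?case using assms[of i] by simp
next
  case (step2 i)
  then show ?case using assms[of "i - 1"] by simp
qed simp

lemma nn_integral_unit_step_count:
  fixes t :: "int \<Rightarrow> real"
  assumes "\<And>k. t (k + 1) - t k = 1"
  shows "(\<integral>\<^sup>+k. ennreal (indicator {-1..1} (a - t k)) \<partial>count_space UNIV) \<le> 3"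
proof -
  define b where "b = \<lfloor>a - t 0\<rfloor>"
  let ?F = "{b - 1, b, b + 1}"
  have "(\<integral>\<^sup>+k. ennreal (indicator {-1..1} (a - t k)) \<partial>count_space UNIV)
      \<le> (\<integral>\<^sup>+k. indicator ?F k \<partial>count_space UNIV)"
  proof (rule nn_integral_mono)
    fix k :: int
    have "k \<in> ?F" if "a - t k \<in> {-1..1}"
    proof -
      have "of_int k - 1 \<le> a - t 0" "a - t 0 \<le> of_int k + 1"
        using that unit_step_eq[of t, OF assms, of k] by auto
      then have "k - 1 \<le> b" "b \<le> k + 1" unfolding b_def by linarith+
      then show ?thesis by auto
    qed
    then show "ennreal (indicator {-1..1} (a - t k)) \<le> indicator ?F k"
      by (auto simp: indicator_def)
  qed
  also have "\<dots> = of_nat (card ?F)"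
    by simp
  also have "\<dots> \<le> 3" by simp
  finally show ?thesis .
qed

lemma abs_moment_0_eq:
  "abs_moment 0 t G = (SUP x\<in>{0<..}. \<integral>\<^sup>+k. ennreal (G (exp (- t k) * x)) \<partial>count_space UNIV)"
  unfolding abs_moment_def by (simp add: infsum_eq_nn_integral_count_space)

lemma nn_integral_le_abs_moment_0:
  "0 < x \<Longrightarrow> (\<integral>\<^sup>+k. ennreal (G (exp (- t k) * x)) \<partial>count_space UNIV) \<le> abs_moment 0 t G"
  unfolding abs_moment_0_eq by (rule SUP_upper) auto

text \<open>At most three nodes lie within distance 1 of \<open>ln x\<close>, each contributing at
  most \<open>B\<close>; at all other nodes the factor
  \<open>\<bar>ln x - t k\<bar> powr \<beta>\<close> is at least 1, so that they are controlled by
  the moment of order \<open>\<beta>\<close>.\<close>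

lemma abs_moment_0_finite:
  assumes t: "\<And>k. t (k + 1) - t k = 1"
    and B: "0 \<le> B" "\<And>x. 0 < x \<Longrightarrow> G x \<le> B" and beta: "0 < \<beta>" "abs_moment \<beta> t G < \<infinity>"
  shows "abs_moment 0 t G < \<infinity>"
proof -
  have "abs_moment 0 t G \<le> ennreal B * 3 + abs_moment \<beta> t G"
    unfolding abs_moment_0_eq
  proof (rule SUP_least)
    fix x :: real assume "x \<in> {0<..}"
    then have x: "0 < x" by simp
    have "(\<integral>\<^sup>+k. ennreal (G (exp (- t k) * x)) \<partial>count_space UNIV)
      \<le> (\<integral>\<^sup>+k. ennreal B * ennreal (indicator {-1..1} (ln x - t k))
          + ennreal (G (exp (- t k) * x) * \<bar>ln x - t k\<bar> powr \<beta>) \<partial>count_space UNIV)"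
    proof (rule nn_integral_mono)
      fix k
      show "ennreal (G (exp (- t k) * x)) \<le> ennreal B * ennreal (indicator {-1..1} (ln x - t k))
          + ennreal (G (exp (- t k) * x) * \<bar>ln x - t k\<bar> powr \<beta>)"
      proof (cases "ln x - t k \<in> {-1..1}")
        case True
        then show ?thesis using B(2)[of "exp (- t k) * x"] x
          by (auto intro!: add_increasing2 ennreal_leI)
      next
        case False
        then have "1 \<le> \<bar>ln x - t k\<bar> powr \<beta>" using beta by (intro ge_one_powr_ge_zero) auto
        then have "ennreal (G (exp (- t k) * x)) \<le> ennreal (G (exp (- t k) * x) * \<bar>ln x - t k\<bar> powr \<beta>)"
          using mult_left_mono[of 1 "\<bar>ln x - t k\<bar> powr \<beta>" "G (exp (- t k) * x)"]
          by (cases "0 \<le> G (exp (- t k) * x)") (auto simp: ennreal_neg intro!: ennreal_leI)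
        then show ?thesis by (simp add: add_increasing)
      qed
    qed
    also have "\<dots> = ennreal B * (\<integral>\<^sup>+k. ennreal (indicator {-1..1} (ln x - t k)) \<partial>count_space UNIV)
        + (\<Sum>\<^sub>\<infinity>k. ennreal (G (exp (- t k) * x) * \<bar>ln x - t k\<bar> powr \<beta>))"
      by (simp add: nn_integral_add nn_integral_cmult infsum_eq_nn_integral_count_space)
    also have "\<dots> \<le> ennreal B * 3 + abs_moment \<beta> t G"
    proof (intro add_mono mult_left_mono nn_integral_unit_step_count[where t=t, OF t])
      show "(\<Sum>\<^sub>\<infinity>k. ennreal (G (exp (- t k) * x) * \<bar>ln x - t k\<bar> powr \<beta>)) \<le> abs_moment \<beta> t G"
        unfolding abs_moment_def using beta x by (intro SUP_upper2[of x]) auto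
    qed auto
    finally show "(\<integral>\<^sup>+k. ennreal (G (exp (- t k) * x)) \<partial>count_space UNIV)
      \<le> ennreal B * 3 + abs_moment \<beta> t G" .
  qed
  also have "\<dots> < \<infinity>" using beta by (auto simp: ennreal_mult_less_top less_top)
  finally show ?thesis .
qed

lemma indicator_one_exp:
  fixes x a :: real
  shows "0 < x \<Longrightarrow> indicator {1..exp 1} (exp (- a) * x) = (indicator {0..1} (ln x - a) :: real)"
proof -
  assume "0 < x"
  then have "exp (- a) * x = exp (ln x - a)" by (simp add: exp_diff exp_minus divide_inverse)
  moreover have "1 \<le> exp (ln x - a) \<longleftrightarrow> 0 \<le> ln x - a" by simp
  moreover have "exp (ln x - a) \<le> exp 1 \<longleftrightarrow> ln x - a \<le> 1" by (simp only: exp_le_cancel_iff)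
  ultimately show ?thesis by (simp only: indicator_def atLeastAtMost_iff)
qed

lemma abs_moment_0_indicator_finite:
  assumes t: "\<And>k. t (k + 1) - t k = 1"
  shows "abs_moment 0 t (indicator {1..exp 1}) < \<infinity>"
proof -
  have "abs_moment 0 t (indicator {1..exp 1}) \<le> 3"
    unfolding abs_moment_0_eq
  proof (rule SUP_least)
    fix x :: real assume "x \<in> {0<..}"
    then have x: "0 < x" by simp
    have "(\<integral>\<^sup>+k. ennreal (indicator {1..exp 1} (exp (- t k) * x)) \<partial>count_space UNIV)
      \<le> (\<integral>\<^sup>+k. ennreal (indicator {-1..1} (ln x - t k)) \<partial>count_space UNIV)"
      unfolding indicator_one_exp[OF x] by (intro nn_integral_mono) (auto simp: indicator_def)
    also have "\<dots> \<le> 3" by (rule nn_integral_unit_step_count[where t=t, OF t])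
    finally show "(\<integral>\<^sup>+k. ennreal (indicator {1..exp 1} (exp (- t k) * x)) \<partial>count_space UNIV) \<le> 3" .
  qed
  also have "\<dots> < (\<infinity>::ennreal)" by simp
  finally show ?thesis .
qed

text \<open>The mean of \<open>G\<close> over the cell \<open>[a, a + 1/w]\<close> is the integral of \<open>G (a + s)\<close> over \<open>window w\<close>.\<close>

definition window :: "real \<Rightarrow> real measure"
  where "window w = density lborel (\<lambda>s. ennreal (w * indicator {0..1 / w} s))"

lemma sets_window [measurable_cong, simp]: "sets (window w) = sets borel"
  and space_window [simp]: "space (window w) = UNIV"
  by (simp_all add: window_def)

lemma emeasure_window: "0 < w \<Longrightarrow> emeasure (window w) UNIV = 1"
  unfolding window_def
  by (subst emeasure_density)
     (auto simp: ennreal_mult' ennreal_indicator nn_integral_cmult ennreal_mult[symmetric])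

lemma finite_measure_window: "0 < w \<Longrightarrow> finite_measure (window w)"
  by (rule finite_measureI) (simp add: emeasure_window)

lemma AE_window: "0 < w \<Longrightarrow> AE s in window w. 0 \<le> s \<and> s \<le> 1 / w"
  unfolding window_def by (subst AE_density) (auto simp: indicator_def)

lemma nn_integral_window:
  "h \<in> borel_measurable borel \<Longrightarrow>
    (\<integral>\<^sup>+s. h s \<partial>window w) = (\<integral>\<^sup>+s. ennreal (w * indicator {0..1 / w} s) * h s \<partial>lborel)"
  unfolding window_def by (subst nn_integral_density) auto

lemma nn_integral_lborel_shift:
  fixes c :: real
  assumes "h \<in> borel_measurable borel"
  shows "(\<integral>\<^sup>+u. h (c + u) \<partial>lborel) = (\<integral>\<^sup>+u. h u \<partial>lborel)"
  using nn_integral_real_affine[OF assms, of 1 c] by simp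

text \<open>
  The cells are closed, so they may overlap at their end points; the number of cells that contain \<open>u\<close>
  is a value of the series defining \<open>M\<^sub>0(\<tau>)\<close>.
\<close>

lemma nn_integral_windows_le:
  fixes t :: "int \<Rightarrow> real"
  assumes w: "0 < w" and h[measurable]: "h \<in> borel_measurable borel"
  shows "(\<integral>\<^sup>+k. \<integral>\<^sup>+s. h (t k / w + s) \<partial>window w \<partial>count_space UNIV)
    \<le> ennreal w * abs_moment 0 t (indicator {1..exp 1}) * (\<integral>\<^sup>+u. h u \<partial>lborel)"
proof -
  have "(\<integral>\<^sup>+s. h (t k / w + s) \<partial>window w)
      = (\<integral>\<^sup>+u. ennreal (w * indicator {0..1 / w} (u - t k / w)) * h u \<partial>lborel)" for k
    using nn_integral_lborel_shift[of "\<lambda>u. ennreal (w * indicator {0..1 / w} (u - t k / w)) * h u" "t k / w"]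
    by (simp add: nn_integral_window)
  then have "(\<integral>\<^sup>+k. \<integral>\<^sup>+s. h (t k / w + s) \<partial>window w \<partial>count_space UNIV)
      = (\<integral>\<^sup>+k. \<integral>\<^sup>+u. ennreal (w * indicator {0..1 / w} (u - t k / w)) * h u \<partial>lborel \<partial>count_space UNIV)"
    by simp
  also have "\<dots> = (\<integral>\<^sup>+u. \<integral>\<^sup>+k. ennreal (w * indicator {0..1 / w} (u - t k / w)) * h u \<partial>count_space UNIV \<partial>lborel)"
    by (rule nn_integral_count_space_nn_integral[symmetric]) auto
  also have "\<dots> \<le> (\<integral>\<^sup>+u. ennreal w * abs_moment 0 t (indicator {1..exp 1}) * h u \<partial>lborel)"
  proof (rule nn_integral_mono)
    fix u
    \<comment> \<open>The point \<open>u\<close> lies in the \<open>k\<close>-th cell exactly when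
      \<open>w * u - t k\<close> lies in \<open>[0, 1]\<close>, which is the value of \<tau> at
      \<open>exp (- t k) * exp (w * u)\<close>.\<close>
    have ind: "indicator {0..1 / w} (u - t k / w) = (indicator {1..exp 1} (exp (- t k) * exp (w * u)) :: real)" for k
    proof -
      have "u - t k / w = (w * u - t k) / w" using w by (simp add: field_simps)
      then show ?thesis
        unfolding indicator_one_exp[OF exp_gt_zero] using w
        by (auto simp: indicator_def zero_le_divide_iff divide_le_cancel)
    qed
    have "(\<integral>\<^sup>+k. ennreal (w * indicator {0..1 / w} (u - t k / w)) * h u \<partial>count_space UNIV)
      = ennreal w * (\<integral>\<^sup>+k. ennreal (indicator {1..exp 1} (exp (- t k) * exp (w * u))) \<partial>count_space UNIV) * h u"
      using w unfolding ind by (simp add: ennreal_mult' nn_integral_multc nn_integral_cmult)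
    also have "\<dots> \<le> ennreal w * abs_moment 0 t (indicator {1..exp 1}) * h u"
      by (intro mult_right_mono mult_left_mono nn_integral_le_abs_moment_0) auto
    finally show "(\<integral>\<^sup>+k. ennreal (w * indicator {0..1 / w} (u - t k / w)) * h u \<partial>count_space UNIV)
      \<le> ennreal w * abs_moment 0 t (indicator {1..exp 1}) * h u" .
  qed
  also have "\<dots> = ennreal w * abs_moment 0 t (indicator {1..exp 1}) * (\<integral>\<^sup>+u. h u \<partial>lborel)"
    by (simp add: nn_integral_cmult)
  finally show ?thesis .
qed

text \<open>The density of \<open>window w\<close> is at most \<open>w\<close>. This carries
  finiteness of a modular over to each single cell.\<close>

lemma nn_integral_window_le:
  assumes h[measurable]: "h \<in> borel_measurable borel" and w: "0 < w"
  shows "(\<integral>\<^sup>+s. h (a + s) \<partial>window w) \<le> ennreal w * (\<integral>\<^sup>+u. h u \<partial>lborel)"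
proof -
  have "(\<integral>\<^sup>+s. h (a + s) \<partial>window w) \<le> (\<integral>\<^sup>+s. ennreal w * h (a + s) \<partial>lborel)"
    unfolding nn_integral_window[OF measurable_compose[OF _ h], of "\<lambda>s. a + s", simplified]
    using w by (intro nn_integral_mono mult_right_mono ennreal_leI) (auto simp: indicator_def)
  also have "\<dots> = ennreal w * (\<integral>\<^sup>+u. h u \<partial>lborel)"
    by (simp add: nn_integral_cmult nn_integral_lborel_shift)
  finally show ?thesis .
qed

text \<open>
  If the mean of \<open>\<bar>G\<bar>\<close> were infinite, Jensen's inequality would bound \<open>\<phi>\<close>. This is what makes the
  mean values in the operator meaningful for \<open>f\<close> in the Orlicz space.
\<close>

lemma integrable_window:
  assumes phi: "phi_function \<phi>" "convex_on {0..} \<phi>" and c: "0 < c" and w: "0 < w"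
    and G[measurable]: "G \<in> borel_measurable borel"
    and fin: "(\<integral>\<^sup>+v. ennreal (\<phi> \<bar>c * G v\<bar>) \<partial>lborel) < \<infinity>"
  shows "integrable (window w) (\<lambda>s. G (a + s))"
proof -
  note [measurable] = borel_measurable_phi_abs_compose[OF phi(1)]
  have "(\<integral>\<^sup>+s. ennreal (\<phi> \<bar>c * G (a + s)\<bar>) \<partial>window w)
      \<le> ennreal w * (\<integral>\<^sup>+v. ennreal (\<phi> \<bar>c * G v\<bar>) \<partial>lborel)"
    using w by (intro nn_integral_window_le) auto
  also have "\<dots> < \<infinity>" using fin by (simp add: ennreal_mult_less_top)
  finally obtain X where X: "(\<integral>\<^sup>+s. ennreal (\<phi> \<bar>c * G (a + s)\<bar>) \<partial>window w) = ennreal X" "0 \<le> X"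
    by (cases "\<integral>\<^sup>+s. ennreal (\<phi> \<bar>c * G (a + s)\<bar>) \<partial>window w") auto
  have "(\<integral>\<^sup>+s. ennreal \<bar>c * G (a + s)\<bar> \<partial>window w) < \<infinity>"
  proof (rule ccontr)
    assume "\<not> (\<integral>\<^sup>+s. ennreal \<bar>c * G (a + s)\<bar> \<partial>window w) < \<infinity>"
    then have top: "(\<integral>\<^sup>+s. ennreal \<bar>c * G (a + s)\<bar> \<partial>window w) = top" by (metis less_top infinity_ennreal_def)
    \<comment> \<open>With an infinite mean, Jensen's inequality for total mass 1 may be used with
      every \<open>r\<close>; the growth of \<open>\<phi>\<close> then gives the
      contradiction.\<close>
    have "\<phi> r \<le> X" if "0 \<le> r" for r
      using jensen_submass[OF phi, of "\<lambda>s. c * G (a + s)" "window w" 1 r] that w X top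
      by (simp add: emeasure_window)
    moreover have "\<forall>\<^sub>F r in at_top. X < \<phi> r \<and> 0 \<le> r"
      using phi(1) by (intro eventually_conj eventually_ge_at_top)
        (auto simp: phi_function_def filterlim_at_top_dense)
    ultimately show False
      by (auto dest!: eventually_happens'[OF trivial_limit_at_top_linorder] simp: not_less[symmetric])
  qed
  then have "integrable (window w) (\<lambda>s. c * G (a + s))"
    by (intro integrableI_bounded) auto
  then show ?thesis using c by simp
qed

lemma integral_window:
  fixes g :: "real \<Rightarrow> real"
  assumes "g \<in> borel_measurable borel" "0 < w"
  shows "(\<integral>s. g s \<partial>window w) = (\<integral>s. w * indicator {0..1 / w} s * g s \<partial>lborel)"
  unfolding window_def using assms by (subst integral_density) auto

text \<open>Puts the mean values of the operator into the form used in the estimates: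
  \<open>F\<close> is replaced by its Borel version, and the cell is translated to start at
  0.\<close>

lemma set_integral_lebesgue_eq_window:
  fixes F G :: "real \<Rightarrow> real"
  assumes FG: "AE v in lborel. F v = G v" and G[measurable]: "G \<in> borel_measurable borel" and w: "0 < w"
    and b: "b = a + 1 / w"
  shows "w * (LINT u:{a..b}|lebesgue. F u) = (\<integral>s. G (a + s) \<partial>window w)"
proof -
  have F: "F \<in> borel_measurable lebesgue"
  proof (rule borel_measurable_AE)
    show "G \<in> borel_measurable lebesgue" by (intro measurable_completion) simp
    show "AE v in lebesgue. G v = F v" using AE_completion[OF FG] by eventually_elim simp
  qed
  have "(LINT u:{a..b}|lebesgue. F u) = (\<integral>u. indicator {a..b} u * G u \<partial>lebesgue)"
    unfolding set_lebesgue_integral_def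
  proof (rule integral_cong_AE)
    show "AE u in lebesgue. indicat_real {a..b} u *\<^sub>R F u = indicat_real {a..b} u * G u"
      using AE_completion[OF FG] by eventually_elim simp
    show "(\<lambda>u. indicat_real {a..b} u *\<^sub>R F u) \<in> borel_measurable lebesgue"
      by (intro borel_measurable_scaleR F measurable_completion) simp
    show "(\<lambda>u. indicat_real {a..b} u * G u) \<in> borel_measurable lebesgue"
      by (intro measurable_completion) simp
  qed
  also have "\<dots> = (\<integral>u. indicator {a..b} u * G u \<partial>lborel)"
    by (rule integral_completion) simp
  also have "\<dots> = (\<integral>s. indicator {a..b} (a + s) * G (a + s) \<partial>lborel)"
    using lborel_integral_real_affine[of 1 "\<lambda>u. indicator {a..b} u * G u" a] by simp
  also have "w * \<dots> = (\<integral>s. w * indicator {0..1 / w} s * G (a + s) \<partial>lborel)"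
    unfolding integral_mult_right_zero[symmetric] b
    by (intro Bochner_Integration.integral_cong) (auto simp: indicator_def)
  also have "\<dots> = (\<integral>s. G (a + s) \<partial>window w)"
    using w by (simp add: integral_window)
  finally show ?thesis .
qed

section \<open>The pointwise error estimate\<close>

text \<open>The intermediate value is the series \<open>S\<close> with all mean values replaced by
  \<open>f x\<close>. The distance to \<open>S\<close> is bounded by the
  \<open>\<psi>\<close>-condition on the kernel, and the distance from \<open>S\<close> to
  \<open>f x\<close> is the defect at \<open>u = f x\<close> times
  \<open>\<bar>f x\<bar>\<close>.\<close>

lemma kantorovich_error_le:
  assumes K: "starred_kernel t L \<psi> \<alpha> \<beta> \<kappa>" and t: "\<And>k. t (k + 1) - t k = 1"
    and w: "0 < w" and x: "0 < x" and d: "0 \<le> d" "kernel_defect t \<kappa> w x \<le> ennreal d"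
    and m: "\<And>k. m k = w * (LINT u:{t k / w..t (k + 1) / w}|lebesgue. f (exp u))"
  shows "ennreal \<bar>kantorovich t \<kappa> w f x - f x\<bar>
    \<le> (\<integral>\<^sup>+k. ennreal (L (exp (- t k) * x powr w) * \<psi> \<bar>m k - f x\<bar>) \<partial>count_space UNIV)
      + ennreal (\<bar>f x\<bar> * d)"
proof -
  define y where "y k = exp (- t k) * x powr w" for k
  have y: "0 < y k" for k using x unfolding y_def by simp
  have kf: "kantorovich t \<kappa> w f x = (\<Sum>\<^sub>\<infinity>k. \<kappa> (y k) (m k))"
    unfolding kantorovich_def y_def using t m by simp
  define S where "S = (\<Sum>\<^sub>\<infinity>k. \<kappa> (y k) (f x))"
  have "ennreal \<bar>(\<Sum>\<^sub>\<infinity>k. \<kappa> (y k) (m k)) - S\<bar>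
      \<le> (\<integral>\<^sup>+k. ennreal \<bar>\<kappa> (y k) (m k) - \<kappa> (y k) (f x)\<bar> \<partial>count_space UNIV)"
    unfolding S_def
    by (rule abs_infsum_diff_le_nn_integral) (use K w x in \<open>auto simp: starred_kernel_def y_def\<close>)
  also have "\<dots> \<le> (\<integral>\<^sup>+k. ennreal (L (y k) * \<psi> \<bar>m k - f x\<bar>) \<partial>count_space UNIV)"
    by (intro nn_integral_mono ennreal_leI) (use K y in \<open>auto simp: starred_kernel_def\<close>)
  finally have 1: "ennreal \<bar>(\<Sum>\<^sub>\<infinity>k. \<kappa> (y k) (m k)) - S\<bar>
      \<le> (\<integral>\<^sup>+k. ennreal (L (y k) * \<psi> \<bar>m k - f x\<bar>) \<partial>count_space UNIV)" .
  \<comment> \<open>The supremum in the defect omits \<open>u = 0\<close>, so the case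
    \<open>f x = 0\<close> is treated through \<open>\<kappa> x 0 = 0\<close>.\<close>
  have 2: "\<bar>S - f x\<bar> \<le> \<bar>f x\<bar> * d"
  proof (cases "f x = 0")
    case True
    then have "S = 0" unfolding S_def using K y by (simp add: starred_kernel_def)
    then show ?thesis using True by simp
  next
    case False
    have "ennreal \<bar>1 / f x * S - 1\<bar> \<le> kernel_defect t \<kappa> w x"
      unfolding kernel_defect_def S_def y_def using False by (intro SUP_upper2[of "f x"]) auto
    also note d(2)
    finally have "\<bar>1 / f x * S - 1\<bar> \<le> d" using d(1) by simp
    then have "\<bar>f x\<bar> * \<bar>1 / f x * S - 1\<bar> \<le> \<bar>f x\<bar> * d" by (intro mult_left_mono) auto
    moreover have "\<bar>f x\<bar> * \<bar>1 / f x * S - 1\<bar> = \<bar>S - f x\<bar>"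
      using False by (simp add: abs_mult[symmetric] right_diff_distrib)
    ultimately show ?thesis by simp
  qed
  have "ennreal \<bar>kantorovich t \<kappa> w f x - f x\<bar>
      \<le> ennreal (\<bar>(\<Sum>\<^sub>\<infinity>k. \<kappa> (y k) (m k)) - S\<bar> + \<bar>f x\<bar> * d)"
    unfolding kf using 2 by (intro ennreal_leI) linarith
  also have "\<dots> = ennreal \<bar>(\<Sum>\<^sub>\<infinity>k. \<kappa> (y k) (m k)) - S\<bar> + ennreal (\<bar>f x\<bar> * d)"
    using d by (intro ennreal_plus) auto
  also have "\<dots> \<le> (\<integral>\<^sup>+k. ennreal (L (y k) * \<psi> \<bar>m k - f x\<bar>) \<partial>count_space UNIV) + ennreal (\<bar>f x\<bar> * d)"
    using 1 by (intro add_right_mono)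
  finally show ?thesis unfolding y_def .
qed

text \<open>\<open>\<phi>\<close> takes only real arguments, so a possibly infinite bound
  \<open>A\<close> is replaced by a real \<open>a\<close> below it; for infinite \<open>A\<close>
  the choice \<open>a = z\<close> works.\<close>

lemma ennreal_le_add_split:
  assumes "ennreal z \<le> A + ennreal B" "0 \<le> z" "0 \<le> B"
  obtains a where "0 \<le> a" "ennreal a \<le> A" "z \<le> a + B"
proof (cases A)
  case (real a)
  then have "z \<le> a + B" using assms by (metis ennreal_le_iff ennreal_plus add_nonneg_nonneg)
  then show ?thesis using real that by auto
next
  case top
  then show ?thesis using assms that[of z] by auto
qed

text \<open>The error \<open>z\<close> is bounded by three pieces, which
  \<open>convex_add3_le\<close> separates at the price of a factor 3 inside \<open>\<phi>\<close>.
  The number \<open>\<nu>\<close> is so small that this factor is absorbed by \<open>C / M\<close>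
  in the first two pieces and by \<open>c / D\<close> in the defect piece. The \<open>a k\<close>
  stand for the kernel weights and \<open>p\<close> for the power of \<open>w\<close> in the
  defect.\<close>

lemma modular_integrand_le:
  fixes t :: "int \<Rightarrow> real" and a :: "int \<Rightarrow> real"
  assumes phi: "phi_function \<phi>" "convex_on {0..} \<phi>" and eta: "phi_function \<eta>" "convex_on {0..} \<eta>"
    and psi: "mono_on {0..} \<psi>" "\<psi> 0 = 0"
    and comp: "\<And>u. 0 \<le> u \<Longrightarrow> \<phi> (C * \<psi> u) \<le> \<eta> (\<rho> * u)" and lam: "0 < \<rho>"
    and w: "0 < w" and G[measurable]: "G \<in> borel_measurable borel"
    and int: "\<And>b. integrable (window w) (\<lambda>s. G (b + s))"
    and a: "\<And>k. 0 \<le> a k" "(\<integral>\<^sup>+k. ennreal (a k) \<partial>count_space UNIV) \<le> ennreal M" and M: "0 < M"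
    and nu: "0 < \<nu>" "3 * \<nu> * M \<le> C"
    and d: "0 \<le> d" "d \<le> D * p" "0 \<le> p" "p \<le> 1" "3 * \<nu> * D \<le> c"
    and z: "ennreal \<bar>z\<bar> \<le> (\<integral>\<^sup>+k. ennreal (a k * \<psi> \<bar>(\<integral>s. G (t k / w + s) \<partial>window w) - G v\<bar>) \<partial>count_space UNIV)
      + ennreal (\<bar>G v\<bar> * d)"
  shows "ennreal (\<phi> \<bar>\<nu> * z\<bar>) \<le> ennreal (1 / 3) *
    (ennreal (1 / M) * (\<integral>\<^sup>+k. ennreal (a k) *
          (\<integral>\<^sup>+s. ennreal (\<eta> \<bar>2 * \<rho> * (G (t k / w + s) - G (v + s))\<bar>) \<partial>window w) \<partial>count_space UNIV)
     + (\<integral>\<^sup>+s. ennreal (\<eta> \<bar>2 * \<rho> * (G (v + s) - G v)\<bar>) \<partial>window w)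
     + ennreal p * ennreal (\<phi> \<bar>c * G v\<bar>))"
proof -
  \<comment> \<open>\<open>P k\<close> measures the distance of the cell from the window that starts
    at \<open>v\<close>, and \<open>Q\<close> that of this window from the value at
    \<open>v\<close>.\<close>
  define P where "P k = (\<integral>s. \<bar>G (t k / w + s) - G (v + s)\<bar> \<partial>window w)" for k
  define Q where "Q = (\<integral>s. \<bar>G (v + s) - G v\<bar> \<partial>window w)"
  interpret W: finite_measure "window w"
    by (rule finite_measure_window[OF w])
  have W1: "measure (window w) UNIV = 1"
    by (simp add: measure_def emeasure_window w)
  have P0: "0 \<le> P k" for k unfolding P_def by simp
  have Q0: "0 \<le> Q" unfolding Q_def by simp
  have psi0: "0 \<le> \<psi> u" if "0 \<le> u" for u using mono_onD[OF psi(1), of 0 u] psi(2) that by simp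
  have m: "\<bar>(\<integral>s. G (t k / w + s) \<partial>window w) - G v\<bar> \<le> P k + Q" for k
  proof -
    have "(\<integral>s. G (t k / w + s) \<partial>window w) - G v = (\<integral>s. G (t k / w + s) - G v \<partial>window w)"
      using int by (simp add: W1)
    also have "\<bar>\<dots>\<bar> \<le> (\<integral>s. \<bar>G (t k / w + s) - G v\<bar> \<partial>window w)" by (rule integral_abs_bound)
    also have "\<dots> \<le> (\<integral>s. \<bar>G (t k / w + s) - G (v + s)\<bar> + \<bar>G (v + s) - G v\<bar> \<partial>window w)"
      using int by (intro integral_mono) auto
    also have "\<dots> = P k + Q" unfolding P_def Q_def using int by (intro Bochner_Integration.integral_add) auto
    finally show ?thesis .
  qed
  \<comment> \<open>Monotonicity alone gives this: the sum is at most twice the larger of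
    \<open>P k\<close> and \<open>Q\<close>. Here the factor 2 in \<open>2 * \<rho>\<close>
    arises.\<close>
  have psi_m: "\<psi> \<bar>(\<integral>s. G (t k / w + s) \<partial>window w) - G v\<bar> \<le> \<psi> (2 * P k) + \<psi> (2 * Q)" for k
  proof (cases "P k \<le> Q")
    case True
    have "\<psi> \<bar>(\<integral>s. G (t k / w + s) \<partial>window w) - G v\<bar> \<le> \<psi> (2 * Q)"
      using m[of k] True Q0 by (intro mono_onD[OF psi(1)]) auto
    then show ?thesis using psi0[of "2 * P k"] P0[of k] by simp
  next
    case False
    have "\<psi> \<bar>(\<integral>s. G (t k / w + s) \<partial>window w) - G v\<bar> \<le> \<psi> (2 * P k)"
      using m[of k] False P0[of k] by (intro mono_onD[OF psi(1)]) auto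
    then show ?thesis using psi0[of "2 * Q"] Q0 by simp
  qed
  let ?A = "\<integral>\<^sup>+k. ennreal (a k * \<psi> (2 * P k)) \<partial>count_space UNIV"
  have zle: "ennreal \<bar>z\<bar> \<le> ?A + ennreal (M * \<psi> (2 * Q) + \<bar>G v\<bar> * d)"
  proof -
    have "(\<integral>\<^sup>+k. ennreal (a k * \<psi> \<bar>(\<integral>s. G (t k / w + s) \<partial>window w) - G v\<bar>) \<partial>count_space UNIV)
      \<le> (\<integral>\<^sup>+k. ennreal (a k * \<psi> (2 * P k)) + ennreal (a k) * ennreal (\<psi> (2 * Q)) \<partial>count_space UNIV)"
    proof (rule nn_integral_mono)
      fix k
      have "ennreal (a k * \<psi> \<bar>(\<integral>s. G (t k / w + s) \<partial>window w) - G v\<bar>)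
         \<le> ennreal (a k * \<psi> (2 * P k) + a k * \<psi> (2 * Q))"
        using mult_left_mono[OF psi_m[of k] a(1)[of k]] by (intro ennreal_leI) (simp add: distrib_left)
      also have "\<dots> = ennreal (a k * \<psi> (2 * P k)) + ennreal (a k) * ennreal (\<psi> (2 * Q))"
        using a(1) psi0 P0 Q0 by (simp add: ennreal_plus ennreal_mult)
      finally show "ennreal (a k * \<psi> \<bar>(\<integral>s. G (t k / w + s) \<partial>window w) - G v\<bar>)
         \<le> ennreal (a k * \<psi> (2 * P k)) + ennreal (a k) * ennreal (\<psi> (2 * Q))" .
    qed
    also have "\<dots> = ?A + (\<integral>\<^sup>+k. ennreal (a k) \<partial>count_space UNIV) * ennreal (\<psi> (2 * Q))"
      by (simp add: nn_integral_add nn_integral_multc)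
    also have "\<dots> \<le> ?A + ennreal M * ennreal (\<psi> (2 * Q))"
      by (intro add_left_mono mult_right_mono a(2)) auto
    also have "\<dots> = ?A + ennreal (M * \<psi> (2 * Q))"
      using M psi0 Q0 by (simp add: ennreal_mult)
    finally have "ennreal \<bar>z\<bar> \<le> (?A + ennreal (M * \<psi> (2 * Q))) + ennreal (\<bar>G v\<bar> * d)"
      using z by (meson add_right_mono order_trans)
    also have "\<dots> = ?A + ennreal (M * \<psi> (2 * Q) + \<bar>G v\<bar> * d)"
      using M psi0 Q0 d(1) by (simp add: ennreal_plus add.assoc)
    finally show ?thesis .
  qed
  have "0 \<le> M * \<psi> (2 * Q) + \<bar>G v\<bar> * d" using M psi0[of "2 * Q"] Q0 d(1) by simp
  \<comment> \<open>The series may still be infinite; \<open>b\<close> is a real share of it that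
    suffices for \<open>z\<close>.\<close>
  then obtain b where b: "0 \<le> b" "ennreal b \<le> ?A" "\<bar>z\<bar> \<le> b + (M * \<psi> (2 * Q) + \<bar>G v\<bar> * d)"
    by (rule ennreal_le_add_split[OF zle abs_ge_zero])
  note [measurable] = borel_measurable_phi_abs_compose[OF eta(1)]
  \<comment> \<open>Jensen's inequality for the probability measure \<open>window w\<close>.\<close>
  have mean: "ennreal (\<eta> (\<rho> * (2 * (\<integral>s. \<bar>g s\<bar> \<partial>window w)))) \<le> (\<integral>\<^sup>+s. ennreal (\<eta> \<bar>2 * \<rho> * g s\<bar>) \<partial>window w)"
    if g: "integrable (window w) g" for g
  proof -
    have gi: "integrable (window w) (\<lambda>s. \<bar>2 * \<rho> * g s\<bar>)" using g by auto
    have "ennreal (1 * \<eta> (\<rho> * (2 * (\<integral>s. \<bar>g s\<bar> \<partial>window w)) / 1))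
        \<le> (\<integral>\<^sup>+s. ennreal (\<eta> \<bar>2 * \<rho> * g s\<bar>) \<partial>window w)"
    proof (rule jensen_submass[OF eta])
      have "ennreal (\<rho> * (2 * (\<integral>s. \<bar>g s\<bar> \<partial>window w))) = ennreal (\<integral>s. \<bar>2 * \<rho> * g s\<bar> \<partial>window w)"
        using lam by (simp add: abs_mult mult.assoc mult.left_commute)
      also have "\<dots> = (\<integral>\<^sup>+s. ennreal \<bar>2 * \<rho> * g s\<bar> \<partial>window w)"
        by (rule nn_integral_eq_integral[symmetric, OF gi]) simp
      finally show "ennreal (\<rho> * (2 * (\<integral>s. \<bar>g s\<bar> \<partial>window w))) \<le> (\<integral>\<^sup>+s. ennreal \<bar>2 * \<rho> * g s\<bar> \<partial>window w)"
        by simp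
    qed (use g lam w in \<open>auto simp: emeasure_window\<close>)
    then show ?thesis by simp
  qed
  have comp': "\<phi> (3 * \<nu> * M * \<psi> u) \<le> \<eta> (\<rho> * u)" if "0 \<le> u" for u
  proof -
    have "\<phi> (3 * \<nu> * M * \<psi> u) \<le> \<phi> (C * \<psi> u)"
      using nu M psi0[OF that] by (intro phi_function_mono[OF phi(1)] mult_right_mono) auto
    with comp[OF that] show ?thesis by simp
  qed
  have T1: "ennreal (\<phi> (3 * (\<nu> * b))) \<le> ennreal (1 / M) * (\<integral>\<^sup>+k. ennreal (a k) *
          (\<integral>\<^sup>+s. ennreal (\<eta> \<bar>2 * \<rho> * (G (t k / w + s) - G (v + s))\<bar>) \<partial>window w) \<partial>count_space UNIV)"
  proof -
    let ?N = "density (count_space UNIV) (\<lambda>k. ennreal (a k))"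
    let ?h = "\<lambda>k. 3 * \<nu> * M * \<psi> (2 * P k)"
    have h0: "0 \<le> ?h k" for k using nu M psi0[of "2 * P k"] P0[of k] by simp
    \<comment> \<open>Jensen's inequality for the weights \<open>a k\<close>. The factor
      \<open>M\<close> put into \<open>?h\<close> cancels the division by \<open>M\<close>, leaving
      \<open>3 * \<nu> * b\<close>, and fits the constant in \<open>comp'\<close>.\<close>
    have "ennreal (M * \<phi> ((3 * \<nu> * M * b) / M)) \<le> (\<integral>\<^sup>+k. ennreal (\<phi> \<bar>?h k\<bar>) \<partial>?N)"
    proof (rule jensen_submass[OF phi])
      have "ennreal (3 * \<nu> * M * b) \<le> ennreal (3 * \<nu> * M) * ?A"
        using nu M b by (simp add: ennreal_mult mult_left_mono)
      also have "\<dots> = (\<integral>\<^sup>+k. ennreal (a k) * ennreal \<bar>?h k\<bar> \<partial>count_space UNIV)"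
        using h0 nu M a(1) by (subst nn_integral_cmult[symmetric])
         (auto intro!: nn_integral_cong simp: ennreal_mult[symmetric] psi0 P0 abs_mult mult_ac)
      finally show "ennreal (3 * \<nu> * M * b) \<le> (\<integral>\<^sup>+k. ennreal \<bar>?h k\<bar> \<partial>?N)"
        by (simp add: nn_integral_density)
      show "emeasure ?N (space ?N) \<le> ennreal M" using a(2) by (simp add: emeasure_density)
    qed (use nu M b in auto)
    also have "\<dots> = (\<integral>\<^sup>+k. ennreal (a k) * ennreal (\<phi> (?h k)) \<partial>count_space UNIV)"
      using h0 by (simp add: nn_integral_density)
    also have "\<dots> \<le> (\<integral>\<^sup>+k. ennreal (a k) *
          (\<integral>\<^sup>+s. ennreal (\<eta> \<bar>2 * \<rho> * (G (t k / w + s) - G (v + s))\<bar>) \<partial>window w) \<partial>count_space UNIV)"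
      (is "_ \<le> ?X")
    proof (intro nn_integral_mono mult_left_mono)
      fix k
      have "ennreal (\<phi> (?h k)) \<le> ennreal (\<eta> (\<rho> * (2 * P k)))"
        using comp'[of "2 * P k"] P0[of k] by (intro ennreal_leI) simp
      also have "\<dots> \<le> (\<integral>\<^sup>+s. ennreal (\<eta> \<bar>2 * \<rho> * (G (t k / w + s) - G (v + s))\<bar>) \<partial>window w)"
        unfolding P_def using int by (intro mean) auto
      finally show "ennreal (\<phi> (?h k)) \<le> (\<integral>\<^sup>+s. ennreal (\<eta> \<bar>2 * \<rho> * (G (t k / w + s) - G (v + s))\<bar>) \<partial>window w)" .
    qed simp
    finally have "ennreal (1 / M) * ennreal (M * \<phi> (3 * \<nu> * b)) \<le> ennreal (1 / M) * ?X"
      using M by (intro mult_left_mono) (auto simp: mult.assoc)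
    moreover have "ennreal (1 / M) * ennreal (M * \<phi> (3 * \<nu> * b)) = ennreal (\<phi> (3 * (\<nu> * b)))"
      using M by (subst ennreal_mult'[symmetric]) (auto simp: mult.assoc)
    ultimately show ?thesis by simp
  qed
  have T2: "ennreal (\<phi> (3 * (\<nu> * (M * \<psi> (2 * Q))))) \<le> (\<integral>\<^sup>+s. ennreal (\<eta> \<bar>2 * \<rho> * (G (v + s) - G v)\<bar>) \<partial>window w)"
  proof -
    have "ennreal (\<phi> (3 * (\<nu> * (M * \<psi> (2 * Q))))) \<le> ennreal (\<eta> (\<rho> * (2 * Q)))"
      using comp'[of "2 * Q"] Q0 by (intro ennreal_leI) (simp add: mult.assoc)
    also have "\<dots> \<le> (\<integral>\<^sup>+s. ennreal (\<eta> \<bar>2 * \<rho> * (G (v + s) - G v)\<bar>) \<partial>window w)"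
      unfolding Q_def using int by (intro mean) auto
    finally show ?thesis .
  qed
  \<comment> \<open>Since \<open>p \<le> 1\<close> and \<open>\<phi> 0 = 0\<close>, convexity lets
    \<open>p\<close> pass out of \<open>\<phi>\<close> as a factor.\<close>
  have T3: "\<phi> (3 * (\<nu> * (\<bar>G v\<bar> * d))) \<le> p * \<phi> \<bar>c * G v\<bar>"
  proof (cases "G v = 0")
    case True
    then show ?thesis using phi(1) by (simp add: phi_function_def)
  next
    case False
    have "3 * \<nu> * d \<le> p * (3 * \<nu> * D)"
      using mult_left_mono[OF d(2), of "3 * \<nu>"] nu by (simp add: mult_ac)
    also have "\<dots> \<le> p * c" using d by (intro mult_left_mono) auto
    finally have le: "3 * \<nu> * d \<le> p * c" .
    moreover have "0 \<le> 3 * \<nu> * d" using nu d by simp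
    ultimately have "0 \<le> p * c" by linarith
    have "\<phi> (3 * (\<nu> * (\<bar>G v\<bar> * d))) \<le> \<phi> (p * \<bar>c * G v\<bar>)"
    proof (rule phi_function_mono[OF phi(1)])
      have "3 * (\<nu> * (\<bar>G v\<bar> * d)) = (3 * \<nu> * d) * \<bar>G v\<bar>" by simp
      also have "\<dots> \<le> (p * c) * \<bar>G v\<bar>" by (intro mult_right_mono le) simp
      also have "\<dots> \<le> p * \<bar>c * G v\<bar>"
        using d(3) by (auto simp: abs_mult mult.assoc intro!: mult_left_mono mult_right_mono)
      finally show "3 * (\<nu> * (\<bar>G v\<bar> * d)) \<le> p * \<bar>c * G v\<bar>" .
    qed (use nu d in auto)
    also have "\<dots> \<le> p * \<phi> \<bar>c * G v\<bar>" using d by (intro phi_function_scale_le[OF phi]) auto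
    finally show ?thesis .
  qed
  note nn = phi_function_nonneg[OF phi(1)]
  let ?q = "M * \<psi> (2 * Q)" and ?r = "\<bar>G v\<bar> * d"
  have pos: "0 \<le> \<nu> * b" "0 \<le> \<nu> * ?q" "0 \<le> \<nu> * ?r"
    using nu b(1) M psi0[of "2 * Q"] Q0 d(1) by auto
  have "\<phi> \<bar>\<nu> * z\<bar> \<le> \<phi> (\<nu> * b + \<nu> * ?q + \<nu> * ?r)"
  proof (rule phi_function_mono[OF phi(1)])
    show "\<bar>\<nu> * z\<bar> \<le> \<nu> * b + \<nu> * ?q + \<nu> * ?r"
      using mult_left_mono[OF b(3), of \<nu>] nu by (simp add: abs_mult distrib_left)
  qed simp
  also have "\<dots> \<le> (\<phi> (3 * (\<nu> * b)) + \<phi> (3 * (\<nu> * ?q)) + \<phi> (3 * (\<nu> * ?r))) / 3"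
    by (rule convex_add3_le[OF phi(2) pos])
  finally have "ennreal (\<phi> \<bar>\<nu> * z\<bar>) \<le> ennreal (1 / 3 * (\<phi> (3 * (\<nu> * b)) + \<phi> (3 * (\<nu> * ?q)) + \<phi> (3 * (\<nu> * ?r))))"
    by (intro ennreal_leI) simp
  also have "\<dots> = ennreal (1 / 3) * (ennreal (\<phi> (3 * (\<nu> * b))) + ennreal (\<phi> (3 * (\<nu> * ?q))) + ennreal (\<phi> (3 * (\<nu> * ?r))))"
    using pos by (subst ennreal_mult') (auto simp: ennreal_plus nn)
  also have "\<dots> \<le> ennreal (1 / 3) *
    (ennreal (1 / M) * (\<integral>\<^sup>+k. ennreal (a k) *
          (\<integral>\<^sup>+s. ennreal (\<eta> \<bar>2 * \<rho> * (G (t k / w + s) - G (v + s))\<bar>) \<partial>window w) \<partial>count_space UNIV)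
     + (\<integral>\<^sup>+s. ennreal (\<eta> \<bar>2 * \<rho> * (G (v + s) - G v)\<bar>) \<partial>window w)
     + ennreal p * ennreal (\<phi> \<bar>c * G v\<bar>))"
    using T1 T2 T3 d(3) nn by (intro mult_left_mono add_mono) (auto simp: ennreal_mult[symmetric])
  finally show ?thesis .
qed

section \<open>The integrated estimate\<close>

lemma nn_integral_kernel_term_le:
  fixes t :: "int \<Rightarrow> real" and G \<l> :: "real \<Rightarrow> real"
  assumes eta: "phi_function \<eta>" and w: "0 < w"
    and G[measurable]: "G \<in> borel_measurable borel" and \<l>[measurable]: "\<l> \<in> borel_measurable borel"
  shows "(\<integral>\<^sup>+v. \<integral>\<^sup>+k. ennreal (\<l> (w * v - t k)) *
        (\<integral>\<^sup>+s. ennreal (\<eta> \<bar>l * (G (t k / w + s) - G (v + s))\<bar>) \<partial>window w) \<partial>count_space UNIV \<partial>lborel)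
    \<le> abs_moment 0 t (indicator {1..exp 1}) *
      (\<integral>\<^sup>+r. ennreal w * ennreal (\<l> (w * r)) * (\<integral>\<^sup>+u. ennreal (\<eta> \<bar>l * (G (u + r) - G u)\<bar>) \<partial>lborel) \<partial>lborel)"
proof -
  interpret W: finite_measure "window w" by (rule finite_measure_window[OF w])
  have [simp]: "sigma_finite_measure (window w)" by unfold_locales
  note [measurable] = borel_measurable_phi_abs_compose[OF eta]
  let ?E = "\<lambda>r u. ennreal (\<eta> \<bar>l * (G u - G (u + r))\<bar>)"
  let ?m = "abs_moment 0 t (indicator {1..exp 1})"
  have "(\<integral>\<^sup>+v. \<integral>\<^sup>+k. ennreal (\<l> (w * v - t k)) *
        (\<integral>\<^sup>+s. ennreal (\<eta> \<bar>l * (G (t k / w + s) - G (v + s))\<bar>) \<partial>window w) \<partial>count_space UNIV \<partial>lborel)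
    = (\<integral>\<^sup>+k. \<integral>\<^sup>+v. ennreal (\<l> (w * v - t k)) *
        (\<integral>\<^sup>+s. ennreal (\<eta> \<bar>l * (G (t k / w + s) - G (v + s))\<bar>) \<partial>window w) \<partial>lborel \<partial>count_space UNIV)"
    by (rule nn_integral_count_space_nn_integral) auto
  \<comment> \<open>Under the shift \<open>v = t k / w + r\<close> the index \<open>k\<close>
    survives only in the cell point \<open>t k / w + s\<close>, over which the cells can be
    summed.\<close>
  also have "\<dots> = (\<integral>\<^sup>+k. \<integral>\<^sup>+r. ennreal (\<l> (w * r)) * (\<integral>\<^sup>+s. ?E r (t k / w + s) \<partial>window w) \<partial>lborel \<partial>count_space UNIV)"
  proof (rule nn_integral_cong)
    fix k
    have "(\<integral>\<^sup>+v. ennreal (\<l> (w * v - t k)) *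
        (\<integral>\<^sup>+s. ennreal (\<eta> \<bar>l * (G (t k / w + s) - G (v + s))\<bar>) \<partial>window w) \<partial>lborel)
      = (\<integral>\<^sup>+r. ennreal (\<l> (w * (t k / w + r) - t k)) *
        (\<integral>\<^sup>+s. ennreal (\<eta> \<bar>l * (G (t k / w + s) - G (t k / w + r + s))\<bar>) \<partial>window w) \<partial>lborel)"
      by (rule nn_integral_lborel_shift[symmetric]) measurable
    also have "\<dots> = (\<integral>\<^sup>+r. ennreal (\<l> (w * r)) * (\<integral>\<^sup>+s. ?E r (t k / w + s) \<partial>window w) \<partial>lborel)"
      using w by (simp add: distrib_left add_ac)
    finally show "(\<integral>\<^sup>+v. ennreal (\<l> (w * v - t k)) *
        (\<integral>\<^sup>+s. ennreal (\<eta> \<bar>l * (G (t k / w + s) - G (v + s))\<bar>) \<partial>window w) \<partial>lborel)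
      = (\<integral>\<^sup>+r. ennreal (\<l> (w * r)) * (\<integral>\<^sup>+s. ?E r (t k / w + s) \<partial>window w) \<partial>lborel)" .
  qed
  also have "\<dots> = (\<integral>\<^sup>+r. \<integral>\<^sup>+k. ennreal (\<l> (w * r)) * (\<integral>\<^sup>+s. ?E r (t k / w + s) \<partial>window w) \<partial>count_space UNIV \<partial>lborel)"
    by (rule nn_integral_count_space_nn_integral[symmetric]) auto
  also have "\<dots> \<le> (\<integral>\<^sup>+r. ?m * (ennreal w * ennreal (\<l> (w * r)) * (\<integral>\<^sup>+u. ennreal (\<eta> \<bar>l * (G (u + r) - G u)\<bar>) \<partial>lborel)) \<partial>lborel)"
  proof (rule nn_integral_mono)
    fix r
    have "(\<integral>\<^sup>+k. ennreal (\<l> (w * r)) * (\<integral>\<^sup>+s. ?E r (t k / w + s) \<partial>window w) \<partial>count_space UNIV)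
        = ennreal (\<l> (w * r)) * (\<integral>\<^sup>+k. \<integral>\<^sup>+s. ?E r (t k / w + s) \<partial>window w \<partial>count_space UNIV)"
      by (rule nn_integral_cmult) simp
    also have "\<dots> \<le> ennreal (\<l> (w * r)) * (ennreal w * ?m * (\<integral>\<^sup>+u. ?E r u \<partial>lborel))"
      by (intro mult_left_mono nn_integral_windows_le w) auto
    also have "(\<integral>\<^sup>+u. ?E r u \<partial>lborel) = (\<integral>\<^sup>+u. ennreal (\<eta> \<bar>l * (G (u + r) - G u)\<bar>) \<partial>lborel)"
      by (simp only: abs_mult abs_minus_commute)
    finally show "(\<integral>\<^sup>+k. ennreal (\<l> (w * r)) * (\<integral>\<^sup>+s. ?E r (t k / w + s) \<partial>window w) \<partial>count_space UNIV)
        \<le> ?m * (ennreal w * ennreal (\<l> (w * r)) * (\<integral>\<^sup>+u. ennreal (\<eta> \<bar>l * (G (u + r) - G u)\<bar>) \<partial>lborel))"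
      by (simp only: mult_ac)
  qed
  also have "\<dots> = ?m * (\<integral>\<^sup>+r. ennreal w * ennreal (\<l> (w * r)) * (\<integral>\<^sup>+u. ennreal (\<eta> \<bar>l * (G (u + r) - G u)\<bar>) \<partial>lborel) \<partial>lborel)"
    by (rule nn_integral_cmult) measurable
  finally show ?thesis .
qed

text \<open>After exchanging the integrals, the shifts \<open>s\<close> are averaged by a
  probability measure concentrated on \<open>[0, 1 / w]\<close>.\<close>

lemma nn_integral_window_term_le:
  fixes G :: "real \<Rightarrow> real"
  assumes eta: "phi_function \<eta>" and w: "0 < w" and G[measurable]: "G \<in> borel_measurable borel"
    and \<Omega>: "\<And>r. \<bar>r\<bar> \<le> 1 / w \<Longrightarrow> (\<integral>\<^sup>+u. ennreal (\<eta> \<bar>l * (G (u + r) - G u)\<bar>) \<partial>lborel) \<le> \<Omega>"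
  shows "(\<integral>\<^sup>+v. \<integral>\<^sup>+s. ennreal (\<eta> \<bar>l * (G (v + s) - G v)\<bar>) \<partial>window w \<partial>lborel) \<le> \<Omega>"
proof -
  interpret W: finite_measure "window w" by (rule finite_measure_window[OF w])
  interpret pair_sigma_finite lborel "window w" by unfold_locales
  note [measurable] = borel_measurable_phi_abs_compose[OF eta]
  have "(\<integral>\<^sup>+v. \<integral>\<^sup>+s. ennreal (\<eta> \<bar>l * (G (v + s) - G v)\<bar>) \<partial>window w \<partial>lborel)
      = (\<integral>\<^sup>+s. \<integral>\<^sup>+v. ennreal (\<eta> \<bar>l * (G (v + s) - G v)\<bar>) \<partial>lborel \<partial>window w)"
    by (rule Fubini'[symmetric]) measurable
  also have "\<dots> \<le> (\<integral>\<^sup>+s. \<Omega> \<partial>window w)"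
    using AE_window[OF w] by (intro nn_integral_mono_AE) (auto intro!: \<Omega>)
  also have "\<dots> = \<Omega>" by (simp add: emeasure_window w)
  finally show ?thesis .
qed

text \<open>Convexity splits the difference into two halves, whose integrals agree by translation
  invariance. The bound is uniform in \<open>r\<close> and serves for the shifts that the modulus of
  smoothness does not reach.\<close>

lemma nn_integral_shift_diff_le:
  fixes G :: "real \<Rightarrow> real"
  assumes eta: "phi_function \<eta>" "convex_on {0..} \<eta>" and G[measurable]: "G \<in> borel_measurable borel"
    and l: "0 \<le> l" "2 * l \<le> c"
  shows "(\<integral>\<^sup>+u. ennreal (\<eta> \<bar>l * (G (u + r) - G u)\<bar>) \<partial>lborel) \<le> (\<integral>\<^sup>+u. ennreal (\<eta> \<bar>c * G u\<bar>) \<partial>lborel)"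
    (is "_ \<le> ?Z")
proof -
  note [measurable] = borel_measurable_phi_abs_compose[OF eta(1)]
  have "(\<integral>\<^sup>+u. ennreal (\<eta> \<bar>l * (G (u + r) - G u)\<bar>) \<partial>lborel)
      \<le> (\<integral>\<^sup>+u. ennreal (1 / 2) * (ennreal (\<eta> \<bar>c * G (r + u)\<bar>) + ennreal (\<eta> \<bar>c * G u\<bar>)) \<partial>lborel)"
  proof (rule nn_integral_mono)
    fix u
    have le: "\<eta> (2 * (l * \<bar>y\<bar>)) \<le> \<eta> \<bar>c * y\<bar>" for y
    proof (rule phi_function_mono[OF eta(1)])
      have "(2 * l) * \<bar>y\<bar> \<le> \<bar>c\<bar> * \<bar>y\<bar>" using l by (intro mult_right_mono) auto
      then show "2 * (l * \<bar>y\<bar>) \<le> \<bar>c * y\<bar>" by (simp add: abs_mult)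
    qed (use l in auto)
    have "\<eta> \<bar>l * (G (u + r) - G u)\<bar> \<le> \<eta> (l * \<bar>G (u + r)\<bar> + l * \<bar>G u\<bar>)"
    proof (rule phi_function_mono[OF eta(1)])
      have "l * \<bar>G (u + r) - G u\<bar> \<le> l * (\<bar>G (u + r)\<bar> + \<bar>G u\<bar>)" using l by (intro mult_left_mono) auto
      then show "\<bar>l * (G (u + r) - G u)\<bar> \<le> l * \<bar>G (u + r)\<bar> + l * \<bar>G u\<bar>"
        using l by (simp add: abs_mult distrib_left)
    qed simp
    also have "\<dots> \<le> (\<eta> (2 * (l * \<bar>G (u + r)\<bar>)) + \<eta> (2 * (l * \<bar>G u\<bar>))) / 2"
      using l by (intro convex_add2_le[OF eta(2)]) auto
    also have "\<dots> \<le> 1 / 2 * (\<eta> \<bar>c * G (u + r)\<bar> + \<eta> \<bar>c * G u\<bar>)"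
      using le[of "G (u + r)"] le[of "G u"] by simp
    finally have "ennreal (\<eta> \<bar>l * (G (u + r) - G u)\<bar>) \<le> ennreal (1 / 2 * (\<eta> \<bar>c * G (r + u)\<bar> + \<eta> \<bar>c * G u\<bar>))"
      by (intro ennreal_leI) (simp add: add.commute)
    also have "\<dots> = ennreal (1 / 2) * (ennreal (\<eta> \<bar>c * G (r + u)\<bar>) + ennreal (\<eta> \<bar>c * G u\<bar>))"
      using phi_function_nonneg[OF eta(1)] by (subst ennreal_mult') (auto simp: ennreal_plus)
    finally show "ennreal (\<eta> \<bar>l * (G (u + r) - G u)\<bar>)
      \<le> ennreal (1 / 2) * (ennreal (\<eta> \<bar>c * G (r + u)\<bar>) + ennreal (\<eta> \<bar>c * G u\<bar>))" .
  qed
  also have "\<dots> = ennreal (1 / 2) * ((\<integral>\<^sup>+u. ennreal (\<eta> \<bar>c * G (r + u)\<bar>) \<partial>lborel) + ?Z)"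
    by (subst nn_integral_cmult, measurable) (subst nn_integral_add, auto)
  also have "(\<integral>\<^sup>+u. ennreal (\<eta> \<bar>c * G (r + u)\<bar>) \<partial>lborel) = ?Z"
    by (rule nn_integral_lborel_shift) measurable
  also have "ennreal (1 / 2) * (?Z + ?Z) = ?Z"
  proof -
    have "ennreal (1 / 2) * (?Z + ?Z) = ennreal (1 / 2) * 2 * ?Z" by (simp add: mult_2 mult.assoc)
    also have "ennreal (1 / 2) * 2 = ennreal (1 / 2) * ennreal 2" by simp
    also have "\<dots> = 1" by (subst ennreal_mult'[symmetric]) auto
    finally show ?thesis by simp
  qed
  finally show ?thesis .
qed

text \<open>Small shifts use \<open>\<Omega>\<close> and the full mass of the kernel, which the
  factor \<open>w\<close> makes independent of \<open>w\<close>; large shifts use \<open>Z\<close>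
  and the tail of the kernel.\<close>

lemma nn_integral_kernel_split_le:
  fixes \<l> :: "real \<Rightarrow> real" and S :: "real \<Rightarrow> ennreal"
  assumes w: "0 < w" and \<l>[measurable]: "\<l> \<in> borel_measurable borel" and S[measurable]: "S \<in> borel_measurable borel"
    and \<Omega>: "\<And>r. \<bar>r\<bar> \<le> \<delta> \<Longrightarrow> S r \<le> \<Omega>" and Z: "\<And>r. S r \<le> Z"
    and T: "ennreal w * (\<integral>\<^sup>+r. ennreal (\<l> (w * r)) * indicator {r. \<bar>r\<bar> > \<delta>} r \<partial>lborel) \<le> T"
  shows "(\<integral>\<^sup>+r. ennreal w * ennreal (\<l> (w * r)) * S r \<partial>lborel) \<le> (\<integral>\<^sup>+v. ennreal (\<l> v) \<partial>lborel) * \<Omega> + T * Z"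
proof -
  have "(\<integral>\<^sup>+r. ennreal w * ennreal (\<l> (w * r)) * S r \<partial>lborel)
    \<le> (\<integral>\<^sup>+r. ennreal w * ennreal (\<l> (w * r)) * \<Omega>
          + ennreal w * (ennreal (\<l> (w * r)) * indicator {r. \<bar>r\<bar> > \<delta>} r) * Z \<partial>lborel)"
  proof (rule nn_integral_mono)
    fix r
    show "ennreal w * ennreal (\<l> (w * r)) * S r \<le> ennreal w * ennreal (\<l> (w * r)) * \<Omega>
          + ennreal w * (ennreal (\<l> (w * r)) * indicator {r. \<bar>r\<bar> > \<delta>} r) * Z"
    proof (cases "\<bar>r\<bar> \<le> \<delta>")
      case True
      then show ?thesis by (intro add_increasing2 mult_left_mono \<Omega>) auto
    next
      case False
      then show ?thesis by (intro add_increasing) (auto intro!: mult_left_mono Z)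
    qed
  qed
  also have "\<dots> = ennreal w * (\<integral>\<^sup>+r. ennreal (\<l> (w * r)) \<partial>lborel) * \<Omega>
      + ennreal w * (\<integral>\<^sup>+r. ennreal (\<l> (w * r)) * indicator {r. \<bar>r\<bar> > \<delta>} r \<partial>lborel) * Z"
    by (simp add: nn_integral_add nn_integral_cmult nn_integral_multc)
  also have "ennreal w * (\<integral>\<^sup>+r. ennreal (\<l> (w * r)) \<partial>lborel) = (\<integral>\<^sup>+v. ennreal (\<l> v) \<partial>lborel)"
    using nn_integral_real_affine[of "\<lambda>v. ennreal (\<l> v)" w 0] w by simp
  also have "(\<integral>\<^sup>+v. ennreal (\<l> v) \<partial>lborel) * \<Omega>
      + ennreal w * (\<integral>\<^sup>+r. ennreal (\<l> (w * r)) * indicator {r. \<bar>r\<bar> > \<delta>} r \<partial>lborel) * Z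
      \<le> (\<integral>\<^sup>+v. ennreal (\<l> v) \<partial>lborel) * \<Omega> + T * Z"
    by (intro add_left_mono mult_right_mono T) auto
  finally show ?thesis .
qed

lemma AE_lborel_affine:
  fixes P :: "real \<Rightarrow> bool"
  assumes c: "c \<noteq> 0" and P: "AE v in lborel. P v"
  shows "AE v in lborel. P (a + c * v)"
proof -
  obtain N where N: "{v \<in> space lborel. \<not> P v} \<subseteq> N" "emeasure lborel N = 0" "N \<in> sets lborel"
    by (rule AE_E[OF P])
  have "AE v in lborel. v \<notin> N" using N by (intro AE_not_in) (auto simp: null_sets_def)
  from AE_borel_affine[OF c _ this, of a] N(3) have "AE v in lborel. a + c * v \<notin> N" by simp
  then show ?thesis
  proof eventually_elim
    case (elim v)
    then show ?case using N(1) by auto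
  qed
qed

text \<open>The integral does not see null sets, so a modular can be computed from a Borel
  representative in the logarithmic coordinate.\<close>

lemma modular_eq_lborel:
  assumes phi: "phi_function \<phi>" and H: "H \<in> borel_measurable borel" and h: "AE v in lborel. h (exp v) = H v"
  shows "modular \<phi> h = (\<integral>\<^sup>+v. ennreal (\<phi> \<bar>H v\<bar>) \<partial>lborel)"
proof -
  note [measurable] = borel_measurable_phi_abs_compose[OF phi H]
  have "AE x in log_measure. h x = H (ln x)"
    using AE_log_measure_ln[OF h] AE_space by eventually_elim (simp add: space_log_measure)
  then have "modular \<phi> h = (\<integral>\<^sup>+x. ennreal (\<phi> \<bar>H (ln x)\<bar>) \<partial>log_measure)"
    unfolding modular_def by (intro nn_integral_cong_AE) auto
  also have "\<dots> = (\<integral>\<^sup>+v. ennreal (\<phi> \<bar>H v\<bar>) \<partial>lborel)"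
    by (rule nn_integral_log_measure_ln) measurable
  finally show ?thesis .
qed

text \<open>A dilation by \<open>exp r\<close> is a translation by \<open>r\<close>, and the
  translate of the exceptional null set is again null.\<close>

lemma modular_dilation_diff_eq:
  assumes eta: "phi_function \<eta>" and G[measurable]: "G \<in> borel_measurable borel"
    and fG: "AE v in lborel. f (exp v) = G v"
  shows "modular \<eta> (\<lambda>s. l * f (s * exp r) - l * f s)
    = (\<integral>\<^sup>+u. ennreal (\<eta> \<bar>l * (G (u + r) - G u)\<bar>) \<partial>lborel)"
proof (rule modular_eq_lborel[OF eta])
  have "AE v in lborel. f (exp (r + 1 * v)) = G (r + 1 * v)" by (rule AE_lborel_affine[OF _ fG]) simp
  with fG show "AE v in lborel. l * f (exp v * exp r) - l * f (exp v) = l * (G (v + r) - G v)"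
    by eventually_elim (simp add: exp_add[symmetric] add.commute right_diff_distrib)
qed measurable

text \<open>If the moment vanished, so would the kernel, and its defect at \<open>u = 1\<close> would be \<open>1\<close> for all \<open>w\<close>.\<close>

lemma starred_kernel_abs_moment_0_pos:
  assumes K: "starred_kernel t L \<psi> \<alpha> \<beta> \<kappa>"
  shows "0 < abs_moment 0 t L"
proof (rule ccontr)
  assume "\<not> 0 < abs_moment 0 t L"
  then have z: "abs_moment 0 t L = 0" by (simp add: not_less)
  have L0: "L x = 0" if "0 < x" for x
  proof -
    have "(\<integral>\<^sup>+k. ennreal (L (exp (- t k) * (exp (t 0) * x))) \<partial>count_space UNIV) \<le> 0"
      using nn_integral_le_abs_moment_0[of "exp (t 0) * x" L t] that z by simp
    \<comment> \<open>A series of nonnegative terms with sum 0 has only zero terms; at the point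
      \<open>exp (t 0) * x\<close> the term with \<open>k = 0\<close> is \<open>L x\<close>.\<close>
    then have "ennreal (L (exp (- t 0) * (exp (t 0) * x))) = 0"
      by (simp add: nn_integral_0_iff_AE AE_count_space del: exp_minus)
    moreover have "exp (- t 0) * (exp (t 0) * x) = x"
      by (simp add: mult.assoc[symmetric] exp_add[symmetric])
    ultimately have "ennreal (L x) = 0" by (simp only:)
    then have "L x \<le> 0" by (rule ennreal_eq_0_iff[THEN iffD1])
    then show ?thesis using K that by (auto simp: starred_kernel_def intro: antisym)
  qed
  have k0: "\<kappa> x u = 0" if "0 < x" for x u
  proof -
    have "\<bar>\<kappa> x u - \<kappa> x 0\<bar> \<le> L x * \<psi> \<bar>u - 0\<bar>" "\<kappa> x 0 = 0"
      using K that unfolding starred_kernel_def by blast+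
    then show ?thesis using L0[OF that] by simp
  qed
  obtain C where C: "\<forall>\<^sub>F w in at_top. \<forall>x>0. kernel_defect t \<kappa> w x \<le> ennreal (C * w powr (- \<alpha>))"
    using K unfolding starred_kernel_def by blast
  have "\<alpha> > 0" using K unfolding starred_kernel_def by blast
  then have "((\<lambda>w. C * w powr (- \<alpha>)) \<longlongrightarrow> C * 0) at_top"
    by (intro tendsto_mult tendsto_const tendsto_neg_powr filterlim_ident) auto
  then have "\<forall>\<^sub>F w in at_top. C * w powr (- \<alpha>) < 1"
    by (intro order_tendstoD) auto
  with C have "\<forall>\<^sub>F w in at_top. kernel_defect t \<kappa> w 1 < 1"
  proof eventually_elim
    case (elim w)
    then have "kernel_defect t \<kappa> w 1 \<le> ennreal (C * w powr (- \<alpha>))" by simp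
    also have "\<dots> < 1" using elim by (simp add: ennreal_less_one_iff)
    finally show ?case .
  qed
  moreover have "1 \<le> kernel_defect t \<kappa> w 1" for w
    unfolding kernel_defect_def by (intro SUP_upper2[of 1]) (auto simp: k0)
  ultimately have "\<forall>\<^sub>F w in (at_top :: real filter). False"
    by (auto elim: eventually_mono simp: not_less[symmetric])
  then show False by simp
qed

lemma starred_kernel_abs_moment_0_finite:
  assumes K: "starred_kernel t L \<psi> \<alpha> \<beta> \<kappa>" and t: "\<And>k. t (k + 1) - t k = 1"
  shows "abs_moment 0 t L < \<infinity>"
proof -
  have "bounded (L ` {0<..})" using K unfolding starred_kernel_def by blast
  then obtain B where B: "\<forall>y\<in>L ` {0<..}. norm y \<le> B" unfolding bounded_iff by blast
  show ?thesis
  proof (rule abs_moment_0_finite[where t=t, OF t])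
    show "0 \<le> max B 0" by simp
    show "L x \<le> max B 0" if "0 < x" for x
    proof -
      have "norm (L x) \<le> B" using B that by blast
      then show ?thesis by auto
    qed
    show "0 < \<beta>" "abs_moment \<beta> t L < \<infinity>" using K unfolding starred_kernel_def by blast+
  qed
qed

lemma modular_mono:
  assumes "\<And>u. 0 \<le> u \<Longrightarrow> \<phi> u \<le> \<eta> u"
  shows "modular \<phi> f \<le> modular \<eta> f"
  unfolding modular_def using assms by (intro nn_integral_mono ennreal_leI) auto

text \<open>
  The kernel is not assumed measurable in its first argument, so \<open>kantorovich t \<kappa> w f\<close> need not be
  measurable; on the left only monotonicity of the integral is used.
\<close>

lemma modular_kantorovich_le:
  fixes t :: "int \<Rightarrow> real" and \<l> G f :: "real \<Rightarrow> real"
  assumes t: "\<And>k. t (k + 1) - t k = 1" and K: "starred_kernel t L \<psi> \<alpha> \<beta> \<kappa>"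
    and phi: "phi_function \<phi>" "convex_on {0..} \<phi>" and eta: "phi_function \<eta>" "convex_on {0..} \<eta>"
    and comp: "\<And>u. 0 \<le> u \<Longrightarrow> \<phi> (C * \<psi> u) \<le> \<eta> (\<rho> * u)" and rho: "0 < \<rho>" "4 * \<rho> \<le> c"
    and G[measurable]: "G \<in> borel_measurable borel" and fG: "AE v in lborel. f (exp v) = G v"
    and \<l>[measurable]: "\<l> \<in> borel_measurable borel" and L\<l>: "AE v in lborel. L (exp v) = \<l> v"
    and fin: "modular \<phi> (\<lambda>x. c * f x) < \<infinity>"
    and M: "0 < M" "abs_moment 0 t L = ennreal M"
    and nu: "0 < \<nu>" "3 * \<nu> * M \<le> C" "3 * \<nu> * D \<le> c"
    and w: "1 \<le> w" and D: "0 \<le> D" "\<And>x. 0 < x \<Longrightarrow> kernel_defect t \<kappa> w x \<le> ennreal (D * w powr (- \<alpha>))"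
    and T: "ennreal w * (\<integral>\<^sup>+y\<in>{y. \<bar>ln y\<bar> > \<delta>}. ennreal (L (y powr w)) \<partial>log_measure) \<le> T"
  shows "modular \<phi> (\<lambda>x. \<nu> * (kantorovich t \<kappa> w f x - f x)) \<le> ennreal (1 / 3) *
    (ennreal (1 / M) * (abs_moment 0 t (indicator {1..exp 1}) *
        (ennreal (LINT x|log_measure. \<bar>L x\<bar>) * log_modulus \<eta> (\<lambda>x. 2 * \<rho> * f x) \<delta>
          + T * modular \<eta> (\<lambda>x. c * f x)))
     + log_modulus \<eta> (\<lambda>x. 2 * \<rho> * f x) (1 / w)
     + ennreal (w powr (- \<alpha>)) * modular \<phi> (\<lambda>x. c * f x))"
proof -
  have w0: "0 < w" and c0: "0 < c" using w rho by auto
  interpret W: finite_measure "window w" by (rule finite_measure_window[OF w0])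
  have [simp]: "sigma_finite_measure (window w)" by unfold_locales
  note [measurable] = borel_measurable_phi_abs_compose[OF phi(1)] borel_measurable_phi_abs_compose[OF eta(1)]
  have alpha: "0 < \<alpha>" and psi: "mono_on {0..} \<psi>" "\<psi> 0 = 0" and L0: "\<And>x. 0 < x \<Longrightarrow> 0 \<le> L x"
    and Lint: "integrable log_measure L"
    using K unfolding starred_kernel_def by blast+
  let ?S = "\<lambda>r. \<integral>\<^sup>+u. ennreal (\<eta> \<bar>2 * \<rho> * (G (u + r) - G u)\<bar>) \<partial>lborel"
  let ?K1 = "\<lambda>v. \<integral>\<^sup>+k. ennreal (\<l> (w * v - t k)) *
     (\<integral>\<^sup>+s. ennreal (\<eta> \<bar>2 * \<rho> * (G (t k / w + s) - G (v + s))\<bar>) \<partial>window w) \<partial>count_space UNIV"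
  let ?K2 = "\<lambda>v. \<integral>\<^sup>+s. ennreal (\<eta> \<bar>2 * \<rho> * (G (v + s) - G v)\<bar>) \<partial>window w"
  let ?K3 = "\<lambda>v. ennreal (w powr (- \<alpha>)) * ennreal (\<phi> \<bar>c * G v\<bar>)"
  let ?B = "\<lambda>v. ennreal (1 / 3) * (ennreal (1 / M) * ?K1 v + ?K2 v + ?K3 v)"
  have K1m[measurable]: "?K1 \<in> borel_measurable borel"
    by (rule borel_measurable_nn_integral_count_space) measurable
  have modc: "modular \<theta> (\<lambda>x. c * f x) = (\<integral>\<^sup>+v. ennreal (\<theta> \<bar>c * G v\<bar>) \<partial>lborel)"
    if "phi_function \<theta>" for \<theta>
    by (rule modular_eq_lborel[OF that]) (use fG in auto)
  have S_eq: "?S r = modular \<eta> (\<lambda>s. 2 * \<rho> * f (s * exp r) - 2 * \<rho> * f s)" for r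
    by (rule modular_dilation_diff_eq[OF eta(1) G fG, symmetric])
  have S_le: "?S r \<le> log_modulus \<eta> (\<lambda>x. 2 * \<rho> * f x) d" if "\<bar>r\<bar> \<le> d" for r d
    unfolding S_eq log_modulus_def using that by (intro SUP_upper2[of "exp r"]) auto
  \<comment> \<open>The condition \<open>4 * \<rho> \<le> c\<close> enters here: one factor 2
    belongs to \<open>2 * \<rho>\<close>, the other to splitting the difference.\<close>
  have S_le_mod: "?S r \<le> modular \<eta> (\<lambda>x. c * f x)" for r
    unfolding modc[OF eta(1)] using rho by (intro nn_integral_shift_diff_le[OF eta G]) auto

  \<comment> \<open>Countably many exceptional null sets are united, so that all kernel weights at
    one point may be replaced together.\<close>
  have "AE v in lborel. \<forall>k. L (exp (- t k + w * v)) = \<l> (- t k + w * v)"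
    unfolding AE_all_countable using w0 by (intro allI AE_lborel_affine[OF _ L\<l>]) auto
  with fG have AE: "AE v in lborel. f (exp v) = G v \<and> (\<forall>k. L (exp (- t k + w * v)) = \<l> (- t k + w * v))"
    by eventually_elim simp
  have "AE x in log_measure. ennreal (\<phi> \<bar>\<nu> * (kantorovich t \<kappa> w f x - f x)\<bar>) \<le> ?B (ln x)"
    using AE_log_measure_ln[OF AE] AE_space
  proof eventually_elim
    case (elim x)
    then have x: "0 < x" and fx: "f x = G (ln x)"
      and L: "\<And>k. L (exp (- t k + w * ln x)) = \<l> (- t k + w * ln x)"
      by (auto simp: space_log_measure)
    define a where "a k = L (exp (- t k) * x powr w)" for k
    have a_eq: "a k = \<l> (w * ln x - t k)" for k
      using L[of k] x by (simp add: a_def powr_def mult_exp_exp)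
    have "ennreal (\<phi> \<bar>\<nu> * (kantorovich t \<kappa> w f x - f x)\<bar>) \<le> ennreal (1 / 3) *
      (ennreal (1 / M) * (\<integral>\<^sup>+k. ennreal (a k) *
          (\<integral>\<^sup>+s. ennreal (\<eta> \<bar>2 * \<rho> * (G (t k / w + s) - G (ln x + s))\<bar>) \<partial>window w) \<partial>count_space UNIV)
       + ?K2 (ln x) + ?K3 (ln x))"
    \<comment> \<open>Here \<open>v = ln x\<close>, \<open>p = w powr (- \<alpha>)\<close> and
      \<open>d = D * p\<close>; the assumption \<open>1 \<le> w\<close> ensures
      \<open>p \<le> 1\<close>.\<close>
    proof (rule modular_integrand_le[OF phi eta psi comp rho(1) w0 G])
      show "integrable (window w) (\<lambda>s. G (b + s))" for b
        by (rule integrable_window[OF phi c0 w0 G]) (use fin modc[OF phi(1)] in simp)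
      show "0 \<le> a k" for k unfolding a_def using x by (intro L0) simp
      show "(\<integral>\<^sup>+k. ennreal (a k) \<partial>count_space UNIV) \<le> ennreal M"
        unfolding a_def M(2)[symmetric] using x by (intro nn_integral_le_abs_moment_0) simp
      show "w powr (- \<alpha>) \<le> 1" using w alpha by (simp add: powr_minus_divide ge_one_powr_ge_zero)
      show "ennreal \<bar>kantorovich t \<kappa> w f x - f x\<bar>
        \<le> (\<integral>\<^sup>+k. ennreal (a k * \<psi> \<bar>(\<integral>s. G (t k / w + s) \<partial>window w) - G (ln x)\<bar>) \<partial>count_space UNIV)
          + ennreal (\<bar>G (ln x)\<bar> * (D * w powr (- \<alpha>)))"
        unfolding a_def fx[symmetric]
      proof (rule kantorovich_error_le[where t=t, OF K t w0 x])
        show "(\<integral>s. G (t k / w + s) \<partial>window w) = w * (LINT u:{t k / w..t (k + 1) / w}|lebesgue. f (exp u))" for k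
          using t[of k] w0
          by (intro set_integral_lebesgue_eq_window[OF fG G w0, symmetric]) (simp add: add_divide_distrib[symmetric] algebra_simps)
      qed (use D x in auto)
    qed (use M nu D in auto)
    then show ?case unfolding a_eq .
  qed
  then have "modular \<phi> (\<lambda>x. \<nu> * (kantorovich t \<kappa> w f x - f x)) \<le> (\<integral>\<^sup>+x. ?B (ln x) \<partial>log_measure)"
    unfolding modular_def by (rule nn_integral_mono_AE)
  also have "\<dots> = (\<integral>\<^sup>+v. ?B v \<partial>lborel)"
    by (rule nn_integral_log_measure_ln) measurable
  also have "\<dots> = ennreal (1 / 3) * (ennreal (1 / M) * (\<integral>\<^sup>+v. ?K1 v \<partial>lborel) + (\<integral>\<^sup>+v. ?K2 v \<partial>lborel)
      + ennreal (w powr (- \<alpha>)) * modular \<phi> (\<lambda>x. c * f x))"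
    by (simp add: nn_integral_cmult nn_integral_add modc[OF phi(1)])
  also have "\<dots> \<le> ennreal (1 / 3) *
    (ennreal (1 / M) * (abs_moment 0 t (indicator {1..exp 1}) *
        (ennreal (LINT x|log_measure. \<bar>L x\<bar>) * log_modulus \<eta> (\<lambda>x. 2 * \<rho> * f x) \<delta>
          + T * modular \<eta> (\<lambda>x. c * f x)))
     + log_modulus \<eta> (\<lambda>x. 2 * \<rho> * f x) (1 / w)
     + ennreal (w powr (- \<alpha>)) * modular \<phi> (\<lambda>x. c * f x))"
  proof (intro mult_left_mono add_mono order_refl)
    have \<Lambda>: "ennreal (LINT x|log_measure. \<bar>L x\<bar>) = (\<integral>\<^sup>+v. ennreal (\<l> v) \<partial>lborel)"
    proof -
      have "ennreal (LINT x|log_measure. \<bar>L x\<bar>) = (\<integral>\<^sup>+x. ennreal \<bar>L x\<bar> \<partial>log_measure)"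
        using Lint by (intro nn_integral_eq_integral[symmetric]) auto
      also have "\<dots> = (\<integral>\<^sup>+x. ennreal (\<l> (ln x)) \<partial>log_measure)"
      proof (rule nn_integral_cong_AE)
        show "AE x in log_measure. ennreal \<bar>L x\<bar> = ennreal (\<l> (ln x))"
          using AE_log_measure_ln[OF L\<l>] AE_space
        proof eventually_elim
          case (elim x)
          then have "0 < x" "L x = \<l> (ln x)" by (auto simp: space_log_measure)
          then show ?case using L0[of x] by simp
        qed
      qed
      also have "\<dots> = (\<integral>\<^sup>+v. ennreal (\<l> v) \<partial>lborel)"
        by (rule nn_integral_log_measure_ln) measurable
      finally show ?thesis .
    qed
    \<comment> \<open>The tail condition in the logarithmic coordinate, where
      \<open>y powr w\<close> becomes \<open>w * ln y\<close>.\<close>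
    have T': "ennreal w * (\<integral>\<^sup>+r. ennreal (\<l> (w * r)) * indicator {r. \<bar>r\<bar> > \<delta>} r \<partial>lborel) \<le> T"
    proof -
      have "(\<integral>\<^sup>+r. ennreal (\<l> (w * r)) * indicator {r. \<bar>r\<bar> > \<delta>} r \<partial>lborel)
          = (\<integral>\<^sup>+y. ennreal (\<l> (w * ln y)) * indicator {r. \<bar>r\<bar> > \<delta>} (ln y) \<partial>log_measure)"
        by (rule nn_integral_log_measure_ln[symmetric]) measurable
      also have "\<dots> = (\<integral>\<^sup>+y\<in>{y. \<bar>ln y\<bar> > \<delta>}. ennreal (L (y powr w)) \<partial>log_measure)"
      proof (rule nn_integral_cong_AE)
        have "AE v in lborel. L (exp (0 + w * v)) = \<l> (0 + w * v)"
          using w0 by (intro AE_lborel_affine[OF _ L\<l>]) auto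
        from AE_log_measure_ln[OF this] AE_space
        show "AE y in log_measure. ennreal (\<l> (w * ln y)) * indicator {r. \<bar>r\<bar> > \<delta>} (ln y)
            = ennreal (L (y powr w)) * indicator {y. \<bar>ln y\<bar> > \<delta>} y"
          by eventually_elim (auto simp: space_log_measure powr_def indicator_def)
      qed
      finally show ?thesis using T by simp
    qed
    have "(\<integral>\<^sup>+v. ?K1 v \<partial>lborel) \<le> abs_moment 0 t (indicator {1..exp 1}) *
        (\<integral>\<^sup>+r. ennreal w * ennreal (\<l> (w * r)) * ?S r \<partial>lborel)"
      by (rule nn_integral_kernel_term_le[OF eta(1) w0 G \<l>])
    also have "\<dots> \<le> abs_moment 0 t (indicator {1..exp 1}) *
        (ennreal (LINT x|log_measure. \<bar>L x\<bar>) * log_modulus \<eta> (\<lambda>x. 2 * \<rho> * f x) \<delta>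
          + T * modular \<eta> (\<lambda>x. c * f x))"
      unfolding \<Lambda>
      by (intro mult_left_mono nn_integral_kernel_split_le[OF w0 \<l> _ S_le S_le_mod T']) auto
    finally show "(\<integral>\<^sup>+v. ?K1 v \<partial>lborel) \<le> abs_moment 0 t (indicator {1..exp 1}) *
        (ennreal (LINT x|log_measure. \<bar>L x\<bar>) * log_modulus \<eta> (\<lambda>x. 2 * \<rho> * f x) \<delta>
          + T * modular \<eta> (\<lambda>x. c * f x))" .
    show "(\<integral>\<^sup>+v. ?K2 v \<partial>lborel) \<le> log_modulus \<eta> (\<lambda>x. 2 * \<rho> * f x) (1 / w)"
      by (rule nn_integral_window_term_le[OF eta(1) w0 G S_le])
  qed auto
  finally show ?thesis .
qed

text \<open>Every dilation is \<open>exp r\<close> for some \<open>r\<close>, and the estimate for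
  shifts is uniform in \<open>r\<close>. It makes the moduli of smoothness finite in the final
  bound.\<close>

lemma log_modulus_le_modular:
  assumes eta: "phi_function \<eta>" "convex_on {0..} \<eta>" and f: "f \<in> borel_measurable log_measure"
    and l: "0 \<le> l" "2 * l \<le> c"
  shows "log_modulus \<eta> (\<lambda>x. l * f x) \<delta> \<le> modular \<eta> (\<lambda>x. c * f x)"
proof -
  obtain G where G[measurable]: "G \<in> borel_measurable borel" and fG: "AE v in lborel. f (exp v) = G v"
    by (rule borel_version_exp[OF f])
  have m: "modular \<eta> (\<lambda>x. c * f x) = (\<integral>\<^sup>+v. ennreal (\<eta> \<bar>c * G v\<bar>) \<partial>lborel)"
    by (rule modular_eq_lborel[OF eta(1)]) (use fG in auto)
  show ?thesis
    unfolding log_modulus_def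
  proof (rule SUP_least)
    fix t :: real assume "t \<in> {t. 0 < t \<and> \<bar>ln t\<bar> \<le> \<delta>}"
    then have "t = exp (ln t)" by simp
    then obtain r where "t = exp r" by blast
    then show "modular \<eta> (\<lambda>s. l * f (s * t) - l * f s) \<le> modular \<eta> (\<lambda>x. c * f x)"
      using nn_integral_shift_diff_le[OF eta G l, of r]
      by (simp only: m modular_dilation_diff_eq[OF eta(1) G fG])
  qed
qed

text \<open>Finiteness of the bound is part of the conclusion, because between values in
  \<open>ennreal\<close> an inequality with an infinite right-hand side says nothing.\<close>

theorem theorem14:
  fixes t :: "int \<Rightarrow> real"
    and L \<psi> \<phi> \<eta> f :: "real \<Rightarrow> real"
    and \<alpha> \<beta> :: real
    and \<kappa> :: "real \<Rightarrow> real \<Rightarrow> real"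
  assumes "strict_mono t"
    and "\<And>k. t (k + 1) - t k = 1"
    and "starred_kernel t L \<psi> \<alpha> \<beta> \<kappa>"
    and "phi_function \<phi>" and "convex_on {0..} \<phi>"
    and "phi_function \<eta>" and "convex_on {0..} \<eta>"
    and "\<forall>l\<in>{0<..<1}. \<exists>C\<in>{0<..<1}. \<forall>u\<ge>0. \<phi> (C * \<psi> u) \<le> \<eta> (l * u)"
    and "f \<in> mellin_orlicz (\<lambda>u. \<phi> u + \<eta> u)"
    and "\<forall>\<gamma>\<in>{0<..<1}. \<exists>M\<^sub>3>0. \<exists>\<gamma>\<^sub>0>0. tail_decay L \<gamma> M\<^sub>3 \<gamma>\<^sub>0"
  shows "\<forall>\<gamma>\<in>{0<..<1}. \<forall>M\<^sub>3>0. \<forall>\<gamma>\<^sub>0>0. tail_decay L \<gamma> M\<^sub>3 \<gamma>\<^sub>0 \<longrightarrow>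
    (\<exists>\<nu>>0. \<exists>l>0. \<exists>l\<^sub>0>0. \<forall>\<^sub>F w in at_top.
      let \<tau> = indicator {1..exp 1};
          bound =
            ennreal (LINT x|log_measure. \<bar>L x\<bar>) * abs_moment 0 t \<tau> / (3 * abs_moment 0 t L)
              * log_modulus \<eta> (\<lambda>x. l * f x) (1 / w powr \<gamma>)
            + ennreal M\<^sub>3 * abs_moment 0 t \<tau> * modular \<eta> (\<lambda>x. l\<^sub>0 * f x) / (3 * abs_moment 0 t L)
              * ennreal (w powr (- \<gamma>\<^sub>0))
            + 1 / 3 * log_modulus \<eta> (\<lambda>x. l * f x) (1 / w)
            + modular \<phi> (\<lambda>x. l\<^sub>0 * f x) / 3 * ennreal (w powr (- \<alpha>))
      in modular \<phi> (\<lambda>x. \<nu> * (kantorovich t \<kappa> w f x - f x)) \<le> bound \<and> bound < \<infinity>)"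
proof (intro ballI allI impI)
  fix \<gamma> M\<^sub>3 \<gamma>\<^sub>0 :: real
  assume M3: "0 < M\<^sub>3" and tail: "tail_decay L \<gamma> M\<^sub>3 \<gamma>\<^sub>0"
  note t = assms(2) and K = assms(3) and phi = assms(4,5) and eta = assms(6,7)
  have f: "f \<in> borel_measurable log_measure" using assms(9) by (simp add: mellin_orlicz_def)
  obtain c where c: "0 < c" "modular (\<lambda>u. \<phi> u + \<eta> u) (\<lambda>x. c * f x) < \<infinity>"
    using assms(9) by (auto simp: mellin_orlicz_def)
  have phi_fin: "modular \<phi> (\<lambda>x. c * f x) < \<infinity>"
    by (rule le_less_trans[OF modular_mono c(2)]) (simp add: phi_function_nonneg[OF eta(1)])
  have eta_fin: "modular \<eta> (\<lambda>x. c * f x) < \<infinity>"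
    by (rule le_less_trans[OF modular_mono c(2)]) (simp add: phi_function_nonneg[OF phi(1)])
  obtain G where G: "G \<in> borel_measurable borel" "AE v in lborel. f (exp v) = G v"
    by (rule borel_version_exp[OF f])
  have "L \<in> borel_measurable log_measure" using K unfolding starred_kernel_def by blast
  then obtain \<l> where \<l>: "\<l> \<in> borel_measurable borel" "AE v in lborel. L (exp v) = \<l> v"
    by (rule borel_version_exp)
  obtain M where M: "abs_moment 0 t L = ennreal M" "0 < M"
    using starred_kernel_abs_moment_0_finite[where t=t, OF K t] starred_kernel_abs_moment_0_pos[OF K]
    by (cases "abs_moment 0 t L") auto
  obtain D' where D': "\<forall>\<^sub>F w in at_top. \<forall>x>0. kernel_defect t \<kappa> w x \<le> ennreal (D' * w powr (- \<alpha>))"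
    using K unfolding starred_kernel_def by blast
  \<comment> \<open>The constant \<open>D'\<close> may be zero or negative, whereas \<open>D\<close>
    is a divisor in \<open>\<nu>\<close>.\<close>
  define D where "D = max D' 1"
  have D: "0 < D" "D' \<le> D" unfolding D_def by auto
  \<comment> \<open>The bound \<open>1 / 2\<close> keeps \<open>\<rho>\<close> inside
    \<open>(0, 1)\<close>, where the condition linking \<open>\<phi>\<close>, \<open>\<psi>\<close>
    and \<open>\<eta>\<close> applies; \<open>c / 4\<close> leaves room for the two doublings of the
    argument of \<open>\<eta>\<close>.\<close>
  define \<rho> where "\<rho> = min (c / 4) (1 / 2)"
  have rho: "0 < \<rho>" "\<rho> < 1" "4 * \<rho> \<le> c" using c unfolding \<rho>_def by auto
  obtain C where C: "0 < C" "\<And>u. 0 \<le> u \<Longrightarrow> \<phi> (C * \<psi> u) \<le> \<eta> (\<rho> * u)"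
    using assms(8) rho by fastforce
  \<comment> \<open>The first bound absorbs the kernel mass \<open>M\<close>, the second the defect
    constant \<open>D\<close>, each with the factor 3 from the threefold splitting.\<close>
  define \<nu> where "\<nu> = min (C / (3 * M)) (c / (3 * D))"
  have nu0: "0 < \<nu>" using C c M D unfolding \<nu>_def by simp
  have "\<nu> * (3 * M) \<le> C" "\<nu> * (3 * D) \<le> c"
    using M D by (simp_all add: \<nu>_def pos_le_divide_eq[symmetric])
  then have nu: "3 * \<nu> * M \<le> C" "3 * \<nu> * D \<le> c" by (simp_all add: mult_ac)
  let ?\<tau> = "indicator {1..exp 1} :: real \<Rightarrow> real"
  let ?\<Omega> = "log_modulus \<eta> (\<lambda>x. 2 * \<rho> * f x)"
  let ?\<Lambda> = "ennreal (LINT x|log_measure. \<bar>L x\<bar>)"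
  have \<Omega>_fin: "?\<Omega> \<delta> < \<infinity>" for \<delta>
    using log_modulus_le_modular[OF eta f, of "2 * \<rho>" c \<delta>] rho eta_fin by (auto intro: le_less_trans)
  have \<tau>_fin: "abs_moment 0 t ?\<tau> < \<infinity>"
    by (rule abs_moment_0_indicator_finite[where t=t, OF t])
  have third: "1 / (3::ennreal) = ennreal (1 / 3)"
    using divide_ennreal[of 1 3] by simp
  have div3: "x / 3 = ennreal (1 / 3) * x" for x :: ennreal
    using third by (metis divide_ennreal_def mult.commute mult_1)
  \<comment> \<open>The division is harmless because the moment is a positive real number
    \<open>M\<close>; as products, the terms of the bound can be rearranged freely.\<close>
  have divM: "x / (3 * abs_moment 0 t L) = ennreal (1 / 3) * (ennreal (1 / M) * x)" for x
  proof -
    have "3 * abs_moment 0 t L = ennreal (3 * M)" using M by (simp add: ennreal_mult')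
    then have "x / (3 * abs_moment 0 t L) = x * ennreal (1 / 3 * (1 / M))"
      using M by (simp add: divide_ennreal_def inverse_ennreal inverse_eq_divide)
    also have "\<dots> = ennreal (1 / 3) * (ennreal (1 / M) * x)"
      using M by (subst ennreal_mult') (auto simp: mult_ac)
    finally show ?thesis .
  qed
  have "\<forall>\<^sub>F w in at_top.
      modular \<phi> (\<lambda>x. \<nu> * (kantorovich t \<kappa> w f x - f x)) \<le>
        ?\<Lambda> * abs_moment 0 t ?\<tau> / (3 * abs_moment 0 t L) * ?\<Omega> (1 / w powr \<gamma>)
        + ennreal M\<^sub>3 * abs_moment 0 t ?\<tau> * modular \<eta> (\<lambda>x. c * f x) / (3 * abs_moment 0 t L) * ennreal (w powr (- \<gamma>\<^sub>0))
        + 1 / 3 * ?\<Omega> (1 / w) + modular \<phi> (\<lambda>x. c * f x) / 3 * ennreal (w powr (- \<alpha>)) \<and>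
        ?\<Lambda> * abs_moment 0 t ?\<tau> / (3 * abs_moment 0 t L) * ?\<Omega> (1 / w powr \<gamma>)
        + ennreal M\<^sub>3 * abs_moment 0 t ?\<tau> * modular \<eta> (\<lambda>x. c * f x) / (3 * abs_moment 0 t L) * ennreal (w powr (- \<gamma>\<^sub>0))
        + 1 / 3 * ?\<Omega> (1 / w) + modular \<phi> (\<lambda>x. c * f x) / 3 * ennreal (w powr (- \<alpha>)) < \<infinity>"
    using D' tail[unfolded tail_decay_def] eventually_ge_at_top[of 1]
  proof eventually_elim
    case (elim w)
    have "modular \<phi> (\<lambda>x. \<nu> * (kantorovich t \<kappa> w f x - f x)) \<le> ennreal (1 / 3) *
      (ennreal (1 / M) * (abs_moment 0 t ?\<tau> *
        (?\<Lambda> * ?\<Omega> (1 / w powr \<gamma>) + ennreal (M\<^sub>3 * w powr (- \<gamma>\<^sub>0)) * modular \<eta> (\<lambda>x. c * f x)))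
       + ?\<Omega> (1 / w) + ennreal (w powr (- \<alpha>)) * modular \<phi> (\<lambda>x. c * f x))"
    proof (rule modular_kantorovich_le[where t=t, OF t K phi eta C(2) rho(1,3) G \<l> phi_fin M(2,1) nu0 nu elim(3)])
      fix x :: real assume "0 < x"
      then have "kernel_defect t \<kappa> w x \<le> ennreal (D' * w powr (- \<alpha>))" using elim by simp
      also have "\<dots> \<le> ennreal (D * w powr (- \<alpha>))"
        using D by (intro ennreal_leI mult_right_mono) auto
      finally show "kernel_defect t \<kappa> w x \<le> ennreal (D * w powr (- \<alpha>))" .
    qed (use D elim in auto)
    also have "\<dots> = ?\<Lambda> * abs_moment 0 t ?\<tau> / (3 * abs_moment 0 t L) * ?\<Omega> (1 / w powr \<gamma>)
        + ennreal M\<^sub>3 * abs_moment 0 t ?\<tau> * modular \<eta> (\<lambda>x. c * f x) / (3 * abs_moment 0 t L) * ennreal (w powr (- \<gamma>\<^sub>0))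
        + 1 / 3 * ?\<Omega> (1 / w) + modular \<phi> (\<lambda>x. c * f x) / 3 * ennreal (w powr (- \<alpha>))"
      using M3 by (simp only: divM div3 third distrib_left ennreal_mult' less_imp_le mult_ac mult_1_right mult_1_left)
    finally show ?case
      using \<Omega>_fin \<tau>_fin eta_fin phi_fin
      by (auto simp: divM div3 third ennreal_mult_less_top ennreal_add_less_top)
  qed
  then show "\<exists>\<nu>>0. \<exists>l>0. \<exists>l\<^sub>0>0. \<forall>\<^sub>F w in at_top.
      let \<tau> = indicator {1..exp 1};
          bound =
            ennreal (LINT x|log_measure. \<bar>L x\<bar>) * abs_moment 0 t \<tau> / (3 * abs_moment 0 t L)
              * log_modulus \<eta> (\<lambda>x. l * f x) (1 / w powr \<gamma>)
            + ennreal M\<^sub>3 * abs_moment 0 t \<tau> * modular \<eta> (\<lambda>x. l\<^sub>0 * f x) / (3 * abs_moment 0 t L)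
              * ennreal (w powr (- \<gamma>\<^sub>0))
            + 1 / 3 * log_modulus \<eta> (\<lambda>x. l * f x) (1 / w)
            + modular \<phi> (\<lambda>x. l\<^sub>0 * f x) / 3 * ennreal (w powr (- \<alpha>))
      in modular \<phi> (\<lambda>x. \<nu> * (kantorovich t \<kappa> w f x - f x)) \<le> bound \<and> bound < \<infinity>"
    unfolding Let_def using nu0 rho(1) c(1)
    \<comment> \<open>The modulus of smoothness is taken with \<open>l = 2 * \<rho>\<close>, and the
      modulars with \<open>c\<close>, for which both are finite.\<close>
    by (intro exI[of _ \<nu>] exI[of _ "2 * \<rho>"] exI[of _ c] conjI) auto
qed

end
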